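(* Let $g,h\in\mathbb{N}$ and let $G\in\mathcal{H}$. Then there are computable integers $c_k\in\mathbb{N}_0$ for $1\le k\le 5$ such that $\#R_G(X)=pX+O(E(X))$, where $$p=\frac{r}{1+\omega}\left(1+\omega-\sum_{k=1}^{5}c_k\,\omega^{k}\right).$$ If $G\in\mathcal{H}$ has the unique expansion property under $\mathcal{E}$, then $c_k=0$ for all $1\le k\le 5$, i.e., $\#R_G(X)=rX+O(E(X))$. Let $$\ell_0:=\frac{g(G_2+G_1)}{gG_2+hG_1}.$$ The sequence $G$ has the unique expansion property under $\mathcal{E}$ if one of the following is satisfied: (1) $G_2>gG_1$; (2) $G_2>\max\{g,h-1\}$; (3) $G_1>g+h$, provided that $g\le h-1$; (4) $G_1>g(\ell_0+1)+h$, provided that $g\ge h$; e.g., $G_1\ge (g^2+gh+h^2)/h$.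
   Context: $\mathbb{N}$ is the set of positive integers and $\mathbb{N}_0=\mathbb{N}\cup\{0\}$. Fix $g,h\in\mathbb{N}$. $\mathcal{H}$ is the collection of sequences $G=(G_k)_{k\ge1}$ of positive integers such that $G_{k+2}=gG_{k+1}+hG_k$ for all $k\in\mathbb{N}$ and $G_1,G_2$ are distinct and coprime. A coefficient tuple is an infinite tuple $\epsilon=(\epsilon_1,\epsilon_2,\dots)$ of non-negative integers with only finitely many nonzero entries; a finite tuple is identified with an infinite one by appending zeros. Put $\epsilon\cdot G:=\sum_{k\ge1}\epsilon_kG_k$. The semi-proper blocks are the finite tuples $(c)$ with $0\le c\le g-1$ and $(c,g)$ with $0\le c\le h-1$. $\mathcal{E}_{\mathrm p}$ is the set of tuples obtained by concatenating (finitely many) semi-proper blocks; $\mathcal{E}_{\mathrm m}$ is the set of tuples $(g,\epsilon_2,\dots,\epsilon_\ell)$ with $(\epsilon_2,\dots,\epsilon_\ell)\in\mathcal{E}_{\mathrm p}$; $\mathcal{E}:=\mathcal{E}_{\mathrm p}\cup\mathcal{E}_{\mathrm m}$. $G$ has the unique expansion property under $\mathcal{E}$ if the map $\mathcal{E}\to\mathbb{N}_0$, $\epsilon\mapsto\epsilon\cdot G$, is injective. $R_G$ is the set of $n\in\mathbb{N}$ with $n=\epsilon\cdot G$ for some $\epsilon\in\mathcal{E}$, and $R_G(X):=\{n\in R_G:n\le X\}$ for $X\in\mathbb{N}$. $\alpha>1$ and $\beta$ are the two real zeros of $x^2-gx-h$; $\omega:=1/\alpha$; $\beta_0:=|\beta|$;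 $$r:=\frac{(g+1)\alpha+h}{G_2\alpha+hG_1}.$$ The error term is $E(X)=1$ if $\beta_0<1$, $E(X)=\ln X$ if $\beta_0=1$, and $E(X)=X^{\gamma}$ with $\gamma=\log_\alpha\beta_0<1$ if $\beta_0>1$. The $O$-notation is as $X\to\infty$ with $G$ (hence $g,h$) fixed. *)

theory Defs
  imports Complex_Main "HOL-Library.Landau_Symbols"
begin

(* Sequences and coefficient tuples are functions on nat of which only the values at k >= 1
   are meaningful; the value of a sequence at 0 is never used, that of a tuple is 0. *)

definition seqs :: "nat \<Rightarrow> nat \<Rightarrow> (nat \<Rightarrow> nat) set" where
  "seqs g h = {G. (\<forall>k\<ge>1. 0 < G k) \<and> (\<forall>k\<ge>1. G (k + 2) = g * G (k + 1) + h * G k) \<and>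
                  G 1 \<noteq> G 2 \<and> coprime (G 1) (G 2)}"

(* Finite tuples are lists; tuple_of pads with zeros, so lists that differ only in trailing
   zeros become equal. *)
definition tuple_of :: "nat list \<Rightarrow> nat \<Rightarrow> nat" where
  "tuple_of xs k = (if 1 \<le> k \<and> k \<le> length xs then xs ! (k - 1) else 0)"

definition dot :: "(nat \<Rightarrow> nat) \<Rightarrow> (nat \<Rightarrow> nat) \<Rightarrow> nat" where
  "dot \<epsilon> G = (\<Sum>k | 1 \<le> k \<and> \<epsilon> k \<noteq> 0. \<epsilon> k * G k)"

(* Strict bounds on nat: c < g stands for c <= g - 1 without truncated subtraction. *)
definition semi_proper_blocks :: "nat \<Rightarrow> nat \<Rightarrow> nat list set" where
  "semi_proper_blocks g h = {[c] | c. c < g} \<union> {[c, g] | c. c < h}"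

definition block_lists :: "nat \<Rightarrow> nat \<Rightarrow> nat list set" where
  "block_lists g h = {concat bs | bs. set bs \<subseteq> semi_proper_blocks g h}"

definition E_p :: "nat \<Rightarrow> nat \<Rightarrow> (nat \<Rightarrow> nat) set" where
  "E_p g h = tuple_of ` block_lists g h"

definition E_m :: "nat \<Rightarrow> nat \<Rightarrow> (nat \<Rightarrow> nat) set" where
  "E_m g h = {tuple_of (g # xs) | xs. xs \<in> block_lists g h}"

definition E_all :: "nat \<Rightarrow> nat \<Rightarrow> (nat \<Rightarrow> nat) set" where
  "E_all g h = E_p g h \<union> E_m g h"

definition unique_expansion :: "nat \<Rightarrow> nat \<Rightarrow> (nat \<Rightarrow> nat) \<Rightarrow> bool" where
  "unique_expansion g h G \<longleftrightarrow> inj_on (\<lambda>\<epsilon>. dot \<epsilon> G) (E_all g h)"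

definition R :: "nat \<Rightarrow> nat \<Rightarrow> (nat \<Rightarrow> nat) \<Rightarrow> nat set" where
  "R g h G = {n. 1 \<le> n \<and> (\<exists>\<epsilon>\<in>E_all g h. n = dot \<epsilon> G)}"

definition R_upto :: "nat \<Rightarrow> nat \<Rightarrow> (nat \<Rightarrow> nat) \<Rightarrow> nat \<Rightarrow> nat set" where
  "R_upto g h G X = {n \<in> R g h G. n \<le> X}"

definition alpha :: "nat \<Rightarrow> nat \<Rightarrow> real" where
  "alpha g h = (real g + sqrt (real g ^ 2 + 4 * real h)) / 2"

definition beta :: "nat \<Rightarrow> nat \<Rightarrow> real" where
  "beta g h = (real g - sqrt (real g ^ 2 + 4 * real h)) / 2"

lemma zeros_char_poly:
  "{x::real. x ^ 2 - real g * x - real h = 0} = {alpha g h, beta g h}"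
proof -
  define s where "s = sqrt (real g ^ 2 + 4 * real h)"
  have s2: "s ^ 2 = real g ^ 2 + 4 * real h" by (simp add: s_def)
  have *: "x ^ 2 - real g * x - real h = (x - alpha g h) * (x - beta g h)" for x :: real
  proof -
    have "(x - alpha g h) * (x - beta g h) = x ^ 2 - real g * x + (real g ^ 2 - s ^ 2) / 4"
      by (simp add: alpha_def beta_def flip: s_def) (simp add: field_simps power2_eq_square)
    then show ?thesis using s2 by simp
  qed
  show ?thesis unfolding * by auto
qed

lemma alpha_gt_1:
  assumes "1 \<le> g" "1 \<le> h"
  shows "1 < alpha g h"
proof -
  have "1 < real g ^ 2 + 4 * real h"
    using assms by (intro add_strict_increasing2[of "real g ^ 2" 1 "4 * real h"]) auto
  then have "1 < sqrt (real g ^ 2 + 4 * real h)" by simp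
  moreover have "1 \<le> real g" using assms by simp
  ultimately have "2 < real g + sqrt (real g ^ 2 + 4 * real h)" by linarith
  then show ?thesis by (simp add: alpha_def)
qed

definition omega :: "nat \<Rightarrow> nat \<Rightarrow> real" where
  "omega g h = 1 / alpha g h"

definition beta0 :: "nat \<Rightarrow> nat \<Rightarrow> real" where
  "beta0 g h = \<bar>beta g h\<bar>"

definition r_const :: "nat \<Rightarrow> nat \<Rightarrow> (nat \<Rightarrow> nat) \<Rightarrow> real" where
  "r_const g h G = ((real g + 1) * alpha g h + real h) / (real (G 2) * alpha g h + real h * real (G 1))"

definition err :: "nat \<Rightarrow> nat \<Rightarrow> nat \<Rightarrow> real" where
  "err g h X = (if beta0 g h < 1 then 1
                else if beta0 g h = 1 then ln (real X)
                else real X powr (log (alpha g h) (beta0 g h)))"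

definition ell0 :: "nat \<Rightarrow> nat \<Rightarrow> (nat \<Rightarrow> nat) \<Rightarrow> real" where
  "ell0 g h G = real (g * (G 2 + G 1)) / real (g * G 2 + h * G 1)"

(* Total recursive functions of n arguments (Kleene): n-ary functions are functions on lists of
   which only the values at lists of length n matter (rule cong).  Minimisation is restricted to
   the regular case, so that all functions of the class are total. *)
inductive total_recursive :: "nat \<Rightarrow> (nat list \<Rightarrow> nat) \<Rightarrow> bool" where
  zero: "total_recursive n (\<lambda>xs. 0)"
| succ: "total_recursive 1 (\<lambda>xs. Suc (xs ! 0))"
| proj: "i < n \<Longrightarrow> total_recursive n (\<lambda>xs. xs ! i)"
| comp: "total_recursive (length fs) f \<Longrightarrow> (\<And>f'. f' \<in> set fs \<Longrightarrow> total_recursive n f') \<Longrightarrow>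
         total_recursive n (\<lambda>xs. f (map (\<lambda>f'. f' xs) fs))"
| prim_rec: "total_recursive n f \<Longrightarrow> total_recursive (Suc (Suc n)) f' \<Longrightarrow>
         total_recursive (Suc n) (\<lambda>xs. rec_nat (f (tl xs)) (\<lambda>m y. f' (m # y # tl xs)) (hd xs))"
| minim: "total_recursive (Suc n) f \<Longrightarrow> (\<And>xs. length xs = n \<Longrightarrow> \<exists>m. f (m # xs) = 0) \<Longrightarrow>
         total_recursive n (\<lambda>xs. LEAST m. f (m # xs) = 0)"
| cong: "total_recursive n f \<Longrightarrow> (\<And>xs. length xs = n \<Longrightarrow> f' xs = f xs) \<Longrightarrow> total_recursive n f'"

end

theory Submission
  imports Defs
begin

text \<open>
  The idea is to enumerate \<open>\<E> = \<E>\<^sub>p \<union> \<E>\<^sub>m\<close> in lexicographic order, the highest digit being the most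
  significant one. Passing to the next tuple changes the value \<open>\<epsilon> \<cdot> G\<close> by \<open>G 1\<close> if the tuple
  is proper and by \<open>G 2 - g * G 1\<close> if it is modified, because a carry through blocks \<open>(h - 1, g)\<close>
  telescopes by the recurrence. Write \<open>p\<close> and \<open>m\<close> for these two kinds. The kinds of the tuples
  number \<open>0, 1, 2, \<dots>\<close> form an infinite word, and if \<open>U n\<close> and \<open>V n\<close> are the numbers of letters
  \<open>p\<close> and \<open>m\<close> before index \<open>n\<close>, then the \<open>n\<close>-th value is \<open>G 1 * U n + (G 2 - g * G 1) * V n\<close>
  (\<open>val_eq\<close>). Deleting the lowest digit shows that the word is the fixed point of the substitution
  \<open>p \<mapsto> p\<^sup>g m\<close>, \<open>m \<mapsto> p\<^sup>h\<close> (\<open>dig_pos\<close>, \<open>w_pos\<close>): tuple number \<open>pos k + c\<close> has lowest digit \<open>c\<close>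
  and tuple number \<open>k\<close> behind it.

  Each element of \<open>R\<close> is counted once by the last index that has this value, so the number of
  \<^emph>\<open>repeated\<close> indices, those whose value occurs again later, must be found. If \<open>n < n'\<close> have the
  same value, coprimality of \<open>G 1\<close> and \<open>G 2\<close> forces \<open>V n' - V n\<close> to be a positive multiple of
  \<open>G 1\<close>, and monotonicity then yields a collision in which the difference is exactly \<open>G 1\<close>.
  Undoing the substitution turns this into a condition one level higher, where a difference of \<open>V\<close>
  becomes a difference of \<open>U\<close>. After two such steps, only the distance between two letters \<open>p\<close>
  that are fewer than \<open>g\<close> letters \<open>p\<close> apart matters, and it is read off directly
  (\<open>V_at_next_p\<close>). Hence whether an index is repeated depends only on its three lowest digits
  and on the kind of the remaining tuple (\<open>repeated_iff\<close>).

  So the repeated indices form finitely many cylinders, each of which consists of a prefix followed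
  by an arbitrary proper tuple. If the remaining tuple is proper, the prefix has length 3; if it is
  modified, its first digit \<open>g\<close> joins the prefix, which then has length 4. The numbers of these
  cylinders are \<open>c\<^sub>3\<close> and \<open>c\<^sub>4\<close>, finite sums of decidable conditions on \<open>g, h, G 1, G 2\<close>, and a
  prefix of length \<open>k\<close> followed by a proper tuple has density \<open>\<omega>\<^sup>k / (1 + \<omega>)\<close> among all
  indices. If the expansion is unique, no index is repeated, and both numbers vanish. Moreover, the
  inequalities that describe a cylinder contradict each of the four sufficient conditions
  (\<open>unique_expansion_criteria\<close>).

  All errors come from one quantity, \<open>U n - \<alpha> * V n\<close>, which equals the value of the digits as
  a polynomial in \<open>\<beta>\<close>. It is bounded, logarithmic or of order \<open>n powr \<gamma>\<close> according to whether
  \<open>\<bar>\<beta>\<bar>\<close> is smaller than, equal to or greater than 1 (\<open>ex_error_gauge\<close>).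
\<close>

section \<open>Counting the cells of colliding tuples\<close>

text \<open>The cell condition of \<open>repeated_iff\<close> for three lowest digits \<open>c, e, z\<close> of a tuple (lowest
  first), with \<open>a = G 1\<close> and \<open>b = G 2\<close>. The number \<open>j\<close> is how many letters \<open>p\<close> are passed two
  levels up on the way to the collision; the last summand appears if a letter \<open>m\<close> is met there.
  It cannot be met when the rest of the tuple is modified; \<open>z = 0\<close> encodes this, since \<open>j < g\<close>.\<close>
definition collides :: "nat \<Rightarrow> nat \<Rightarrow> nat \<Rightarrow> nat \<Rightarrow> nat \<Rightarrow> nat \<Rightarrow> nat \<Rightarrow> bool" where
  "collides g h a b z e c \<longleftrightarrow>
     (\<exists>j<g. b + h * j \<le> c \<and> a + e \<le> g + g * j + h * of_bool (g \<le> z + j))"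

text \<open>The first sum runs over prefixes \<open>(c)(e)(z)\<close>, the second over prefixes \<open>(c)(e, g)\<close>, written as
  sequences of blocks. In both, \<open>c = g\<close> stands for the leading digit of a modified tuple.\<close>
definition cells_p :: "nat \<Rightarrow> nat \<Rightarrow> nat \<Rightarrow> nat \<Rightarrow> nat" where
  "cells_p g h a b =
     (\<Sum>z<g. \<Sum>e<g. \<Sum>c<Suc g. of_bool (collides g h a b z e c)) +
     (\<Sum>e<h. \<Sum>c<Suc g. of_bool (collides g h a b g e c))"

text \<open>The third digit is the first entry of a block \<open>(z, g)\<close>. All \<open>h\<close> choices of \<open>z\<close> give the same
  condition, whence the factor.\<close>
definition cells_m :: "nat \<Rightarrow> nat \<Rightarrow> nat \<Rightarrow> nat \<Rightarrow> nat" where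
  "cells_m g h a b = h * (\<Sum>e<g. \<Sum>c<Suc g. of_bool (collides g h a b 0 e c))"

section \<open>Computability of the cell counts\<close>

lemma total_recursive_comp2:
  assumes "total_recursive 2 f" "total_recursive n a" "total_recursive n b"
  shows "total_recursive n (\<lambda>xs. f [a xs, b xs])"
proof -
  have "total_recursive (length [a, b]) f" using assms(1) by (simp add: numeral_2_eq_2)
  then have "total_recursive n (\<lambda>xs. f (map (\<lambda>f'. f' xs) [a, b]))"
    by (rule total_recursive.comp) (use assms in auto)
  then show ?thesis by simp
qed

lemma total_recursive_comp1:
  assumes "total_recursive 1 f" "total_recursive n a"
  shows "total_recursive n (\<lambda>xs. f [a xs])"
  using total_recursive.comp[of "[a]" f n] assms by simp

text \<open>The scheme of primitive recursion takes its counter from the head of the argument list and the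
  parameters from the tail; prepending any recursive \<open>b\<close> to the projections supplies both.\<close>
lemma total_recursive_iterate:
  assumes f: "total_recursive n f" and f': "total_recursive (Suc (Suc n)) f'" and b: "total_recursive n b"
  shows "total_recursive n (\<lambda>xs. rec_nat (f xs) (\<lambda>m y. f' (m # y # xs)) (b xs))"
proof -
  let ?R = "\<lambda>xs. rec_nat (f (tl xs)) (\<lambda>m y. f' (m # y # tl xs)) (hd xs)"
  let ?fs = "b # map (\<lambda>i xs. xs ! i) [0..<n]"
  have "total_recursive (length ?fs) ?R" using total_recursive.prim_rec[OF f f'] by simp
  then have "total_recursive n (\<lambda>xs. ?R (map (\<lambda>f'. f' xs) ?fs))"
    by (rule total_recursive.comp) (use b in \<open>auto intro: total_recursive.proj\<close>)
  then show ?thesis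
    by (rule total_recursive.cong) (auto simp: comp_def map_nth)
qed

lemma total_recursive_Suc: "total_recursive n a \<Longrightarrow> total_recursive n (\<lambda>xs. Suc (a xs))"
  using total_recursive_comp1[OF total_recursive.succ] by simp

lemma total_recursive_const: "total_recursive n (\<lambda>_. k)"
  by (induction k) (auto intro: total_recursive.zero total_recursive_Suc)

lemma total_recursive_add:
  assumes "total_recursive n a" "total_recursive n b"
  shows "total_recursive n (\<lambda>xs. a xs + b xs)"
proof -
  have "total_recursive 2 (\<lambda>xs. rec_nat (xs ! 0) (\<lambda>m y. (\<lambda>ys. Suc (ys ! 1)) (m # y # xs)) (xs ! 1))"
    by (intro total_recursive_iterate total_recursive_Suc total_recursive.proj) auto
  moreover have "rec_nat x (\<lambda>m y. Suc y) k = x + k" for x k :: nat by (induction k) auto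
  ultimately have "total_recursive 2 (\<lambda>xs. xs ! 0 + xs ! 1)" by simp
  from total_recursive_comp2[OF this assms] show ?thesis by simp
qed

lemma total_recursive_mult:
  assumes "total_recursive n a" "total_recursive n b"
  shows "total_recursive n (\<lambda>xs. a xs * b xs)"
proof -
  have "total_recursive 2 (\<lambda>xs. rec_nat 0 (\<lambda>m y. (\<lambda>ys. ys ! 1 + ys ! 2) (m # y # xs)) (xs ! 1))"
    by (intro total_recursive_iterate total_recursive_add total_recursive.proj total_recursive.zero) auto
  moreover have "rec_nat 0 (\<lambda>m y. y + x) k = x * k" for x k :: nat by (induction k) auto
  ultimately have "total_recursive 2 (\<lambda>xs. xs ! 0 * xs ! 1)" by simp
  from total_recursive_comp2[OF this assms] show ?thesis by simp
qed

lemma total_recursive_diff: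
  assumes "total_recursive n a" "total_recursive n b"
  shows "total_recursive n (\<lambda>xs. a xs - b xs)"
proof -
  have "total_recursive 1 (\<lambda>xs. rec_nat 0 (\<lambda>m y. (\<lambda>ys. ys ! 0) (m # y # xs)) (xs ! 0))"
    by (intro total_recursive_iterate total_recursive.proj total_recursive.zero) auto
  moreover have "rec_nat 0 (\<lambda>m y. m) k = k - 1" for k :: nat by (cases k) auto
  ultimately have pred: "total_recursive 1 (\<lambda>xs. xs ! 0 - 1)" by simp
  have "total_recursive 4 (\<lambda>ys. [ys ! 1] ! 0 - 1)"
    by (intro total_recursive_comp1[OF pred] total_recursive.proj) auto
  then have "total_recursive 2 (\<lambda>xs. rec_nat (xs ! 0) (\<lambda>m y. (\<lambda>ys. [ys ! 1] ! 0 - 1) (m # y # xs)) (xs ! 1))"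
    by (intro total_recursive_iterate total_recursive.proj) auto
  moreover have "rec_nat x (\<lambda>m y. y - 1) k = x - k" for x k :: nat by (induction k) auto
  ultimately have "total_recursive 2 (\<lambda>xs. xs ! 0 - xs ! 1)" by simp
  from total_recursive_comp2[OF this assms] show ?thesis by simp
qed

lemma total_recursive_le:
  assumes "total_recursive n a" "total_recursive n b"
  shows "total_recursive n (\<lambda>xs. of_bool (a xs \<le> b xs))"
proof -
  have "total_recursive n (\<lambda>xs. 1 - (a xs - b xs))"
    using assms by (intro total_recursive_diff total_recursive_const)
  moreover have "(\<lambda>xs. 1 - (a xs - b xs)) = (\<lambda>xs. of_bool (a xs \<le> b xs))" by auto
  ultimately show ?thesis by simp
qed

lemma total_recursive_conj:
  assumes "total_recursive n (\<lambda>xs. of_bool (P xs))" "total_recursive n (\<lambda>xs. of_bool (Q xs))"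
  shows "total_recursive n (\<lambda>xs. of_bool (P xs \<and> Q xs))"
  using total_recursive_mult[OF assms] by (simp add: of_bool_conj)

text \<open>Bounded summation by primitive recursion on the bound. The summand sees its index as a new first
  argument; the recursion also puts the partial sum in front of the parameters, and composing with
  projections drops it again.\<close>
lemma total_recursive_sum:
  assumes F: "total_recursive (Suc n) F" and b: "total_recursive n b"
  shows "total_recursive n (\<lambda>xs. \<Sum>i<b xs. F (i # xs))"
proof -
  let ?fs = "(\<lambda>ys. ys ! 0) # map (\<lambda>i ys. ys ! i) [2..<Suc (Suc n)]"
  have len: "length ?fs = Suc n" by (simp del: upt_Suc)
  have "total_recursive (length ?fs) F" unfolding len by (rule F)
  then have "total_recursive (Suc (Suc n)) (\<lambda>ys. F (map (\<lambda>f'. f' ys) ?fs))"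
    by (rule total_recursive.comp) (auto intro: total_recursive.proj)
  then have "total_recursive (Suc (Suc n)) (\<lambda>ys. F (ys ! 0 # tl (tl ys)))"
  proof (rule total_recursive.cong)
    fix ys :: "nat list" assume "length ys = Suc (Suc n)"
    then obtain m y xs where "ys = m # y # xs" "length xs = n" by (auto simp: length_Suc_conv)
    moreover have "map (\<lambda>i. (m # y # xs) ! i) [2..<Suc (Suc (length xs))] = xs"
      by (rule nth_equalityI) (auto simp: eval_nat_numeral simp del: upt_Suc)
    ultimately show "F (ys ! 0 # tl (tl ys)) = F (map (\<lambda>f'. f' ys) ?fs)"
      by (simp add: comp_def del: upt_Suc)
  qed
  then have "total_recursive (Suc (Suc n)) (\<lambda>ys. ys ! 1 + F (ys ! 0 # tl (tl ys)))"
    by (intro total_recursive_add total_recursive.proj) auto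
  from total_recursive_iterate[OF total_recursive.zero this b]
  have "total_recursive n (\<lambda>xs. rec_nat 0 (\<lambda>m y. y + F (m # xs)) (b xs))" by simp
  moreover have "rec_nat 0 (\<lambda>m y. y + F (m # xs)) k = (\<Sum>i<k. F (i # xs))" for xs k
    by (induction k) auto
  ultimately show ?thesis by simp
qed

lemma total_recursive_ex_less:
  assumes F: "total_recursive (Suc n) (\<lambda>xs. of_bool (P xs))" and b: "total_recursive n b"
  shows "total_recursive n (\<lambda>xs. of_bool (\<exists>i<b xs. P (i # xs)))"
proof -
  have "total_recursive n (\<lambda>xs. of_bool (1 \<le> (\<Sum>i<b xs. of_bool (P (i # xs)) :: nat)))"
    by (rule total_recursive_le[OF total_recursive_const total_recursive_sum[OF assms]])
  moreover have "1 \<le> (\<Sum>i<k. of_bool (Q i) :: nat) \<longleftrightarrow> (\<exists>i<k. Q i)" for k :: nat and Q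
    by (induction k) (auto simp: less_Suc_eq)
  ultimately show ?thesis by simp
qed

lemmas total_recursive_intros =
  total_recursive_add total_recursive_mult total_recursive_le total_recursive_conj
  total_recursive_Suc total_recursive_const total_recursive.proj

text \<open>The base function has the seven arguments in the order of \<open>collides\<close>; the bounded quantifier
  adds \<open>j\<close> as position 0, which moves every other argument up by one.\<close>
lemma total_recursive_collides:
  assumes "total_recursive n fg" "total_recursive n fh" "total_recursive n fa" "total_recursive n fb"
    "total_recursive n fz" "total_recursive n fe" "total_recursive n fc"
  shows "total_recursive n (\<lambda>xs. of_bool (collides (fg xs) (fh xs) (fa xs) (fb xs) (fz xs) (fe xs) (fc xs)))"
proof -
  have "total_recursive (Suc 7) (\<lambda>ys. of_bool
      (ys ! 4 + ys ! 2 * ys ! 0 \<le> ys ! 7 \<and>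
       ys ! 3 + ys ! 6 \<le> ys ! 1 + ys ! 1 * ys ! 0 + ys ! 2 * of_bool (ys ! 1 \<le> ys ! 5 + ys ! 0)))"
    by (intro total_recursive_intros) auto
  from total_recursive_ex_less[OF this, of "\<lambda>xs. xs ! 0"]
  have *: "total_recursive 7 (\<lambda>xs. of_bool
     (collides (xs ! 0) (xs ! 1) (xs ! 2) (xs ! 3) (xs ! 4) (xs ! 5) (xs ! 6)))"
    unfolding collides_def by (simp add: total_recursive.proj)
  then have *: "total_recursive (length [fg, fh, fa, fb, fz, fe, fc]) (\<lambda>xs. of_bool
     (collides (xs ! 0) (xs ! 1) (xs ! 2) (xs ! 3) (xs ! 4) (xs ! 5) (xs ! 6)))"
    by (simp only: list.size) (simp add: eval_nat_numeral)
  have "total_recursive n (\<lambda>xs. (\<lambda>xs. of_bool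
     (collides (xs ! 0) (xs ! 1) (xs ! 2) (xs ! 3) (xs ! 4) (xs ! 5) (xs ! 6)))
     (map (\<lambda>f'. f' xs) [fg, fh, fa, fb, fz, fe, fc]))"
    by (rule total_recursive.comp[OF *]) (use assms in auto)
  then show ?thesis by simp
qed

lemma total_recursive_cells_p:
  "total_recursive 4 (\<lambda>xs. cells_p (xs ! 0) (xs ! 1) (xs ! 2) (xs ! 3))"
proof -
  have "total_recursive (Suc (Suc (Suc 4)))
     (\<lambda>ys. of_bool (collides (ys ! 3) (ys ! 4) (ys ! 5) (ys ! 6) (ys ! 2) (ys ! 1) (ys ! 0)))"
    by (intro total_recursive_collides total_recursive.proj) auto
  from total_recursive_sum[OF this, of "\<lambda>ys. Suc (ys ! 2)"]
  have "total_recursive (Suc (Suc 4)) (\<lambda>ys. \<Sum>c<Suc (ys ! 2).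
     of_bool (collides (ys ! 2) (ys ! 3) (ys ! 4) (ys ! 5) (ys ! 1) (ys ! 0) c))"
    by (simp add: total_recursive_intros del: sum.lessThan_Suc)
  from total_recursive_sum[OF this, of "\<lambda>ys. ys ! 1"]
  have "total_recursive (Suc 4) (\<lambda>ys. \<Sum>e<ys ! 1. \<Sum>c<Suc (ys ! 1).
     of_bool (collides (ys ! 1) (ys ! 2) (ys ! 3) (ys ! 4) (ys ! 0) e c))"
    by (simp add: total_recursive_intros del: sum.lessThan_Suc)
  from total_recursive_sum[OF this, of "\<lambda>ys. ys ! 0"]
  have 1: "total_recursive 4 (\<lambda>ys. \<Sum>z<ys ! 0. \<Sum>e<ys ! 0. \<Sum>c<Suc (ys ! 0).
     of_bool (collides (ys ! 0) (ys ! 1) (ys ! 2) (ys ! 3) z e c))"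
    by (simp add: total_recursive_intros del: sum.lessThan_Suc)
  have "total_recursive (Suc (Suc 4))
     (\<lambda>ys. of_bool (collides (ys ! 2) (ys ! 3) (ys ! 4) (ys ! 5) (ys ! 2) (ys ! 1) (ys ! 0)))"
    by (intro total_recursive_collides total_recursive.proj) auto
  from total_recursive_sum[OF this, of "\<lambda>ys. Suc (ys ! 1)"]
  have "total_recursive (Suc 4) (\<lambda>ys. \<Sum>c<Suc (ys ! 1).
     of_bool (collides (ys ! 1) (ys ! 2) (ys ! 3) (ys ! 4) (ys ! 1) (ys ! 0) c))"
    by (simp add: total_recursive_intros del: sum.lessThan_Suc)
  from total_recursive_sum[OF this, of "\<lambda>ys. ys ! 1"]
  have 2: "total_recursive 4 (\<lambda>ys. \<Sum>e<ys ! 1. \<Sum>c<Suc (ys ! 0).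
     of_bool (collides (ys ! 0) (ys ! 1) (ys ! 2) (ys ! 3) (ys ! 0) e c))"
    by (simp add: total_recursive_intros del: sum.lessThan_Suc)
  show ?thesis unfolding cells_p_def by (rule total_recursive_add[OF 1 2])
qed

lemma total_recursive_cells_m:
  "total_recursive 4 (\<lambda>xs. cells_m (xs ! 0) (xs ! 1) (xs ! 2) (xs ! 3))"
proof -
  have "total_recursive (Suc (Suc 4))
     (\<lambda>ys. of_bool (collides (ys ! 2) (ys ! 3) (ys ! 4) (ys ! 5) 0 (ys ! 1) (ys ! 0)))"
    by (intro total_recursive_collides total_recursive.proj total_recursive.zero) auto
  from total_recursive_sum[OF this, of "\<lambda>ys. Suc (ys ! 1)"]
  have "total_recursive (Suc 4) (\<lambda>ys. \<Sum>c<Suc (ys ! 1).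
     of_bool (collides (ys ! 1) (ys ! 2) (ys ! 3) (ys ! 4) 0 (ys ! 0) c))"
    by (simp add: total_recursive_intros del: sum.lessThan_Suc)
  from total_recursive_sum[OF this, of "\<lambda>ys. ys ! 0"]
  have "total_recursive 4 (\<lambda>ys. \<Sum>e<ys ! 0. \<Sum>c<Suc (ys ! 0).
     of_bool (collides (ys ! 0) (ys ! 1) (ys ! 2) (ys ! 3) 0 e c))"
    by (simp add: total_recursive_intros del: sum.lessThan_Suc)
  then show ?thesis unfolding cells_m_def
    by (intro total_recursive_mult total_recursive.proj) auto
qed

section \<open>The tuples in lexicographic order\<close>

locale expansions =
  fixes g h :: nat
  assumes g_pos: "1 \<le> g" and h_pos: "1 \<le> h"
begin

text \<open>Reading from the lowest digit, a list is proper if it starts with a block \<open>(c)\<close> or a block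
  \<open>(c, g)\<close>; the tail behind \<open>c\<close> in the second case is a modified list. This mutual recursion avoids
  any mention of blocks.\<close>
fun proper :: "nat list \<Rightarrow> bool" and modified :: "nat list \<Rightarrow> bool" where
  "proper [] = True"
| "proper (c # xs) = (proper xs \<and> c < g \<or> modified xs \<and> c < h)"
| "modified [] = False"
| "modified (c # xs) = (c = g \<and> proper xs)"

lemma proper_not_modified: "proper xs \<Longrightarrow> \<not> modified xs"
  by (induction xs) auto

lemma proper_concat: "set bs \<subseteq> semi_proper_blocks g h \<Longrightarrow> proper (concat bs)"
  by (induction bs) (auto simp: semi_proper_blocks_def)

lemma block_lists_eq_proper: "block_lists g h = {xs. proper xs}"
proof
  show "block_lists g h \<subseteq> {xs. proper xs}"
    using proper_concat by (auto simp: block_lists_def)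
  have "\<exists>bs. set bs \<subseteq> semi_proper_blocks g h \<and> xs = concat bs" if "proper xs" for xs
    using that
  proof (induction xs rule: length_induct)
    case (1 xs)
    show ?case
    proof (cases xs)
      case Nil
      then show ?thesis by (intro exI[of _ "[]"]) simp
    next
      case (Cons c ys)
      show ?thesis
      proof (cases "proper ys \<and> c < g")
        case True
        then obtain bs where "set bs \<subseteq> semi_proper_blocks g h" "ys = concat bs"
          using 1 Cons by auto
        then show ?thesis using True Cons
          by (intro exI[of _ "[c] # bs"]) (auto simp: semi_proper_blocks_def)
      next
        case False
        then have "modified ys" "c < h" using 1 Cons by auto
        then obtain zs where zs: "ys = g # zs" "proper zs" by (cases ys) auto
        then obtain bs where "set bs \<subseteq> semi_proper_blocks g h" "zs = concat bs"
          using 1(1)[rule_format, of zs] Cons by auto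
        then show ?thesis using \<open>c < h\<close> zs Cons
          by (intro exI[of _ "[c, g] # bs"]) (auto simp: semi_proper_blocks_def)
      qed
    qed
  qed
  then show "{xs. proper xs} \<subseteq> block_lists g h" by (auto simp: block_lists_def)
qed

lemma E_all_eq: "E_all g h = tuple_of ` {xs. proper xs \<or> modified xs}"
proof -
  have "modified xs \<longleftrightarrow> (\<exists>ys. xs = g # ys \<and> proper ys)" for xs by (cases xs) auto
  then show ?thesis
    by (auto simp: E_all_def E_p_def E_m_def block_lists_eq_proper)
qed

text \<open>Numbers of proper and of modified tuples that precede a given one. Behind a proper tuple, the
  lowest digit takes \<open>g\<close> values that give proper tuples and one that gives a modified tuple;
  behind a modified tuple, it takes \<open>h\<close> values, all of which give proper tuples.\<close>
fun up :: "nat list \<Rightarrow> nat" and down :: "nat list \<Rightarrow> nat" where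
  "up [] = 0"
| "up (c # xs) = c + g * up xs + h * down xs"
| "down [] = 0"
| "down (c # xs) = up xs"

text \<open>The lexicographic successor: raise the lowest digit if its position allows this, and carry
  otherwise. A proper tail also admits the digit \<open>g\<close>, which makes the list modified.\<close>
fun inc :: "nat list \<Rightarrow> nat list" where
  "inc [] = [1]"
| "inc (c # xs) = (if proper xs \<and> c < g \<or> modified xs \<and> Suc c < h
                   then Suc c # xs else 0 # inc xs)"

text \<open>A carry over a proper tail moves from a modified list to the next one, which starts with 0; behind
  a modified tail, the carry occurs at the digit \<open>h - 1\<close> of a proper list. In both cases the new counts follow
  from those of the tail.\<close>
lemma inc_admissible:
  "proper xs \<or> modified xs \<Longrightarrow>
     (proper (inc xs) \<or> modified (inc xs)) \<and>
     up (inc xs) = up xs + of_bool (proper xs) \<and> down (inc xs) = down xs + of_bool (modified xs)"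
proof (induction xs)
  case Nil
  then show ?case using g_pos by auto
next
  case (Cons c xs)
  have adm: "proper xs \<or> modified xs" using Cons.prems by auto
  note IH = Cons.IH[OF adm]
  show ?case
  proof (cases "proper xs \<and> c < g \<or> modified xs \<and> Suc c < h")
    case True
    then show ?thesis using proper_not_modified[of xs] by auto
  next
    case False
    consider "proper xs" "c = g" | "modified xs" "Suc c = h"
      using False Cons.prems adm proper_not_modified[of xs] by auto
    then show ?thesis
    proof cases
      case 1
      then show ?thesis
        using False IH proper_not_modified[of xs] g_pos h_pos by (auto simp: algebra_simps)
    next
      case 2
      then show ?thesis
        using False IH proper_not_modified[of xs] g_pos h_pos by (auto simp: algebra_simps)
    qed
  qed
qed

definition dig :: "nat \<Rightarrow> nat list" where
  "dig n = (inc ^^ n) []"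

text \<open>The letter at index \<open>n\<close> is \<open>m\<close> if \<open>w n\<close> holds and \<open>p\<close> otherwise.\<close>
definition U :: "nat \<Rightarrow> nat" where "U n = up (dig n)"
definition V :: "nat \<Rightarrow> nat" where "V n = down (dig n)"
definition w :: "nat \<Rightarrow> bool" where "w n \<longleftrightarrow> modified (dig n)"

lemma dig_0 [simp]: "dig 0 = []" and dig_Suc: "dig (Suc n) = inc (dig n)"
  by (simp_all add: dig_def)

lemma dig_admissible: "proper (dig n) \<or> modified (dig n)"
  by (induction n) (use inc_admissible in \<open>auto simp: dig_Suc\<close>)

lemma not_w_iff: "\<not> w n \<longleftrightarrow> proper (dig n)"
  using dig_admissible[of n] proper_not_modified[of "dig n"] by (auto simp: w_def)

lemma U_0 [simp]: "U 0 = 0" and V_0 [simp]: "V 0 = 0" and w_0 [simp]: "\<not> w 0"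
  by (simp_all add: U_def V_def w_def)

lemma U_Suc: "U (Suc n) = U n + of_bool (\<not> w n)" and V_Suc: "V (Suc n) = V n + of_bool (w n)"
  using inc_admissible[OF dig_admissible[of n]] unfolding not_w_iff
  by (auto simp: U_def V_def w_def dig_Suc)

lemma U_plus_V: "U n + V n = n"
  by (induction n) (auto simp: U_Suc V_Suc)

text \<open>After a modified tuple the carry leaves the digit 0 in front, and a modified tuple starts with
  \<open>g \<ge> 1\<close>.\<close>
lemma not_w_Suc: "w n \<Longrightarrow> \<not> w (Suc n)"
proof -
  assume "w n"
  then obtain ys where "dig n = g # ys" "proper ys" unfolding w_def by (cases "dig n") auto
  then show ?thesis using proper_not_modified[of ys] g_pos by (auto simp: w_def dig_Suc)
qed

section \<open>The substitution behind the digits\<close>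

text \<open>The letter at \<open>k\<close> is substituted by a word of length \<open>width k\<close> that starts at index \<open>pos k\<close>.\<close>
definition width :: "nat \<Rightarrow> nat" where "width k = (if w k then h else g + 1)"
definition pos :: "nat \<Rightarrow> nat" where "pos k = (g + 1) * U k + h * V k"

lemma pos_0 [simp]: "pos 0 = 0" by (simp add: pos_def)

lemma pos_Suc: "pos (Suc k) = pos k + width k"
  by (auto simp: pos_def width_def U_Suc V_Suc algebra_simps)

lemma width_pos: "0 < width k"
  using h_pos by (simp add: width_def)

text \<open>Index 0 is excluded because its digit list is empty and not \<open>[0]\<close>; lists obtained by \<open>inc\<close> have
  no trailing zeros. The induction follows \<open>inc\<close>: within the word of \<open>k\<close> the digit is raised, and
  from its last letter a carry leads to the word of \<open>k + 1\<close>.\<close>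
lemma dig_pos: "c < width k \<Longrightarrow> 0 < c \<or> 0 < k \<Longrightarrow> dig (pos k + c) = c # dig k"
proof (induction k arbitrary: c)
  case 0
  then have "0 < c" "c \<le> g" by (auto simp: width_def)
  then show ?case
  proof (induction c rule: nat_induct_non_zero)
    case 1
    then show ?case by (simp add: dig_Suc[of 0, simplified])
  next
    case (Suc c)
    then show ?case by (simp add: dig_Suc)
  qed
next
  case (Suc k)
  show ?case using Suc.prems(1)
  proof (induction c)
    case 0
    define m where "m = width k - 1"
    have m: "m < width k" "width k = Suc m" using width_pos[of k] by (auto simp: m_def)
    have "0 < m \<or> 0 < k" using g_pos by (auto simp: m_def width_def)
    then have "dig (pos k + m) = m # dig k" using Suc.IH m by blast
    moreover have "\<not> (proper (dig k) \<and> m < g \<or> modified (dig k) \<and> Suc m < h)"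
      using m(2) dig_admissible[of k] proper_not_modified[of "dig k"]
      by (auto simp: width_def w_def split: if_splits)
    ultimately show ?case by (auto simp: pos_Suc m(2) dig_Suc)
  next
    case (Suc c)
    then have "dig (pos (Suc k) + c) = c # dig (Suc k)" by simp
    moreover have "proper (dig (Suc k)) \<and> c < g \<or> modified (dig (Suc k)) \<and> Suc c < h"
      using Suc.prems dig_admissible[of "Suc k"] proper_not_modified[of "dig (Suc k)"]
      by (auto simp: width_def w_def split: if_splits)
    ultimately show ?case by (auto simp: dig_Suc simp del: dig_0)
  qed
qed

lemma
  assumes "c < width k"
  shows U_pos: "U (pos k + c) = c + g * U k + h * V k"
    and V_pos: "V (pos k + c) = U k"
    and w_pos: "w (pos k + c) \<longleftrightarrow> \<not> w k \<and> c = g"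
proof -
  have "U (pos k + c) = c + g * U k + h * V k \<and> V (pos k + c) = U k \<and>
        (w (pos k + c) \<longleftrightarrow> \<not> w k \<and> c = g)"
  proof (cases "0 < c \<or> 0 < k")
    case True
    then show ?thesis
      using dig_pos[OF assms] by (auto simp: not_w_iff) (auto simp: U_def V_def w_def)
  next
    case False
    then show ?thesis using g_pos by auto
  qed
  then show "U (pos k + c) = c + g * U k + h * V k" "V (pos k + c) = U k"
    "w (pos k + c) \<longleftrightarrow> \<not> w k \<and> c = g" by auto
qed

lemma pos_ge: "k \<le> pos k"
proof (induction k)
  case (Suc k)
  then show ?case using width_pos[of k] by (simp add: pos_Suc)
qed simp

lemma pos_decomp: "\<exists>k c. n = pos k + c \<and> c < width k"
proof (induction n)
  case 0
  then show ?case using width_pos[of 0] by (intro exI[of _ 0]) auto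
next
  case (Suc n)
  then obtain k c where kc: "n = pos k + c" "c < width k" by auto
  show ?case
  proof (cases "Suc c < width k")
    case True
    then show ?thesis using kc by (intro exI[of _ k] exI[of _ "Suc c"]) auto
  next
    case False
    then have "Suc n = pos (Suc k) + 0" using kc by (simp add: pos_Suc)
    then show ?thesis using width_pos by blast
  qed
qed

section \<open>Values of tuples\<close>

lemma tuple_of_Cons: "tuple_of (c # xs) = (\<lambda>k. if k = 0 then 0 else if k = 1 then c else tuple_of xs (k - 1))"
  by (rule ext) (auto simp: tuple_of_def nth_Cons' Suc_le_eq)

text \<open>The kind of the list is carried along since it determines which digits may be put in front.\<close>
lemma tuple_of_dig_surj:
  "proper xs \<or> modified xs \<Longrightarrow>
     \<exists>n. tuple_of xs = tuple_of (dig n) \<and> (modified xs \<longleftrightarrow> w n)"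
proof (induction xs)
  case Nil
  then show ?case by (intro exI[of _ 0]) auto
next
  case (Cons c xs)
  then have adm: "proper xs \<or> modified xs" by auto
  then obtain k where k: "tuple_of xs = tuple_of (dig k)" "modified xs \<longleftrightarrow> w k" using Cons by auto
  then have pr: "proper xs \<longleftrightarrow> \<not> w k" using adm proper_not_modified by blast
  then have c: "c < width k" using Cons.prems k(2) by (auto simp: width_def)
  have "modified (c # xs) \<longleftrightarrow> w (pos k + c)" using w_pos[OF c] pr by auto
  moreover have "tuple_of (c # xs) = tuple_of (dig (pos k + c))"
  proof (cases "0 < c \<or> 0 < k")
    case True
    then show ?thesis using dig_pos[OF c] k by (simp add: tuple_of_Cons fun_eq_iff)
  next
    case False
    moreover have "tuple_of [] = (\<lambda>_. 0)" by (simp add: tuple_of_def fun_eq_iff)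
    ultimately show ?thesis using k by (auto simp: tuple_of_Cons)
  qed
  ultimately show ?case by blast
qed

lemma E_all_eq_dig: "E_all g h = range (\<lambda>n. tuple_of (dig n))"
  unfolding E_all_eq using tuple_of_dig_surj dig_admissible by (force simp: image_def)

lemma dot_tuple_of: "dot (tuple_of xs) G = (\<Sum>i<length xs. xs ! i * G (Suc i))"
proof -
  have "dot (tuple_of xs) G = (\<Sum>k\<in>{1..length xs}. tuple_of xs k * G k)"
    unfolding dot_def by (intro sum.mono_neutral_left) (auto simp: tuple_of_def)
  also have "\<dots> = (\<Sum>i<length xs. tuple_of xs (Suc i) * G (Suc i))"
    by (rule sum.reindex_bij_witness[of _ Suc "\<lambda>k. k - 1"]) auto
  also have "\<dots> = (\<Sum>i<length xs. xs ! i * G (Suc i))"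
    by (intro sum.cong) (auto simp: tuple_of_def)
  finally show ?thesis .
qed

lemma dot_Nil [simp]: "dot (tuple_of []) G = 0"
  by (simp add: dot_tuple_of)

lemma dot_Cons: "dot (tuple_of (c # xs)) G = c * G 1 + dot (tuple_of xs) (\<lambda>k. G (Suc k))"
  by (simp add: dot_tuple_of sum.lessThan_Suc_shift del: sum.lessThan_Suc)

text \<open>Both sides obey the same Horner scheme, where deleting the lowest digit shifts the sequence.
  The subtracted term of \<open>G 1 * u + (G 2 - g * G 1) * v\<close> stands on the left to stay within the
  natural numbers.\<close>
lemma dot_eq_up_down:
  assumes "\<And>k. 1 \<le> k \<Longrightarrow> G (k + 2) = g * G (k + 1) + h * G k"
  shows "dot (tuple_of xs) G + g * G 1 * down xs = G 1 * up xs + G 2 * down xs"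
  using assms
proof (induction xs arbitrary: G)
  case Nil
  then show ?case by simp
next
  case (Cons c xs)
  have "dot (tuple_of xs) (\<lambda>k. G (Suc k)) + g * G 2 * down xs = G 2 * up xs + G 3 * down xs"
    using Cons.IH[of "\<lambda>k. G (Suc k)"] Cons.prems by (simp add: numeral_2_eq_2 numeral_3_eq_3)
  moreover have "G 3 = g * G 2 + h * G 1" using Cons.prems[of 1] by (simp add: numeral_3_eq_3 numeral_2_eq_2)
  ultimately have "dot (tuple_of xs) (\<lambda>k. G (Suc k)) = G 2 * up xs + h * G 1 * down xs"
    by (simp add: algebra_simps)
  then show ?case by (simp add: dot_Cons algebra_simps)
qed

text \<open>The basic sequence, for which value and index coincide because both steps
  \<open>H 1\<close> and \<open>H 2 - g * H 1\<close> are 1. It shows that different indices have different digits.\<close>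
fun H :: "nat \<Rightarrow> nat" where
  "H 0 = 0"
| "H (Suc 0) = 1"
| "H (Suc (Suc 0)) = g + 1"
| "H (Suc (Suc (Suc k))) = g * H (Suc (Suc k)) + h * H (Suc k)"

lemma H_rec: "1 \<le> k \<Longrightarrow> H (k + 2) = g * H (k + 1) + h * H k"
  by (cases k) auto

lemma dot_dig_H: "dot (tuple_of (dig n)) H = n"
  using dot_eq_up_down[OF H_rec, of "dig n"] U_plus_V[of n] unfolding U_def V_def
  by (simp add: numeral_2_eq_2 algebra_simps)

lemma inj_tuple_dig: "inj (\<lambda>n. tuple_of (dig n))"
  by (rule injI) (metis dot_dig_H)

section \<open>Which tuples share their value with a later one\<close>

lemma U_mono: "m \<le> n \<Longrightarrow> U m \<le> U n" and V_mono: "m \<le> n \<Longrightarrow> V m \<le> V n"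
  by (rule lift_Suc_mono_le[of U], auto simp: U_Suc, rule lift_Suc_mono_le[of V], auto simp: V_Suc)

lemma less_if_U_less: "U m < U n \<Longrightarrow> m < n" and less_if_V_less: "V m < V n \<Longrightarrow> m < n"
  using U_mono[of n m] V_mono[of n m] by (auto simp: not_le[symmetric])

lemma U_hits: "U m \<le> a \<Longrightarrow> a \<le> U n \<Longrightarrow> \<exists>k\<le>n. U k = a"
proof (induction n)
  case (Suc n)
  show ?case
  proof (cases "a \<le> U n")
    case True
    then show ?thesis using Suc by (auto intro: le_SucI)
  next
    case False
    then have "a = U (Suc n)" using Suc.prems by (auto simp: U_Suc split: if_splits)
    then show ?thesis by auto
  qed
qed auto

lemma U_unbounded: "\<exists>n. a \<le> U n"
proof -
  have "a = U a + V a" by (simp add: U_plus_V)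
  also have "\<dots> \<le> g * U a + h * V a"
    using add_mono[OF mult_le_mono1[OF g_pos, of "U a"] mult_le_mono1[OF h_pos, of "V a"]]
    by (simp only: mult_1)
  also have "\<dots> = U (pos a)" using U_pos[OF width_pos[of a]] by simp
  finally show ?thesis by blast
qed

lemma ex_p_position: "\<exists>l. U l = a \<and> \<not> w l"
proof -
  obtain n where "a \<le> U n" using U_unbounded by blast
  then obtain k where k: "U k = a" using U_hits[of 0 a n] by auto
  show ?thesis
  proof (cases "w k")
    case True
    then show ?thesis using k not_w_Suc[of k] by (intro exI[of _ "Suc k"]) (auto simp: U_Suc)
  qed (use k in auto)
qed

text \<open>Counting the letters \<open>p\<close> before it identifies a position that carries such a letter.\<close>
lemma p_position_unique: "U l = U l' \<Longrightarrow> \<not> w l \<Longrightarrow> \<not> w l' \<Longrightarrow> l = l'"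
  using U_mono[of "Suc l" l'] U_mono[of "Suc l'" l]
  by (cases l l' rule: linorder_cases) (auto simp: U_Suc)

definition val :: "(nat \<Rightarrow> nat) \<Rightarrow> nat \<Rightarrow> nat" where
  "val G n = dot (tuple_of (dig n)) G"

definition repeated :: "(nat \<Rightarrow> nat) \<Rightarrow> nat \<Rightarrow> bool" where
  "repeated G n \<longleftrightarrow> (\<exists>n'>n. val G n' = val G n)"

lemma val_eq: "G \<in> seqs g h \<Longrightarrow> val G n + g * G 1 * V n = G 1 * U n + G 2 * V n"
  unfolding val_def U_def V_def by (rule dot_eq_up_down) (auto simp: seqs_def)

text \<open>Let \<open>a\<close> and \<open>s\<close> be the differences of \<open>U\<close> and \<open>V\<close> between two indices with the same value.
  Then \<open>G 1 * a = (g * G 1 - G 2) * s\<close>, so coprimality gives \<open>s = t * G 1\<close> with \<open>t \<ge> 1\<close>. One level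
  up, \<open>s\<close> is a difference of \<open>U\<close>. The position where this difference first reaches \<open>G 1\<close> comes no
  later, and \<open>V\<close> is monotone, so the inequality persists there.\<close>
lemma repeated_imp_shift:
  assumes G: "G \<in> seqs g h" and c: "c < width k" and rep: "repeated G (pos k + c)"
  shows "\<exists>k'. U k' = U k + G 1 \<and> G 2 + h * V k' \<le> c + h * V k"
proof -
  from G have cop: "coprime (G 1) (G 2)" and gp: "0 < G 1" "0 < G 2" by (auto simp: seqs_def)
  define n where "n = pos k + c"
  obtain n' where n': "n < n'" "val G n' = val G n" using rep by (auto simp: repeated_def n_def)
  obtain k' c' where k': "n' = pos k' + c'" "c' < width k'" using pos_decomp by blast
  obtain a where a: "U n' = U n + a" using U_mono[of n n'] n' by (metis le_iff_add less_imp_le)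
  obtain s where s: "V n' = V n + s" using V_mono[of n n'] n' by (metis le_iff_add less_imp_le)
  have eq: "G 1 * a + G 2 * s = g * G 1 * s"
    using val_eq[OF G, of n] val_eq[OF G, of n'] n'(2) unfolding a s by (simp add: algebra_simps)
  then have "G 1 dvd G 1 * a + G 2 * s" by simp
  then have "G 1 dvd G 2 * s" by (simp add: dvd_add_right_iff)
  then have "G 1 dvd s" using cop by (simp add: coprime_dvd_mult_right_iff)
  then obtain t where t: "s = G 1 * t" by blast
  have "G 1 * (a + G 2 * t) = G 1 * (g * s)" using eq t by (simp add: algebra_simps)
  then have at: "a + G 2 * t = g * s" using gp by simp
  have "0 < t"
  proof (rule ccontr)
    assume "\<not> 0 < t"
    then have "n' = n" using at t a s U_plus_V[of n] U_plus_V[of n'] by simp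
    then show False using n' by simp
  qed
  have Uk': "U k' = U k + s" using s V_pos[OF c] V_pos[OF k'(2)] by (simp add: n_def k')
  have "c' + g * U k' + h * V k' = c + g * U k + h * V k + a"
    using a U_pos[OF c] U_pos[OF k'(2)] by (simp add: n_def k')
  then have cc: "c' + h * V k' + G 2 * t = c + h * V k"
    using at unfolding Uk' by (simp add: algebra_simps)
  have "U k + G 1 \<le> U k'" using Uk' t \<open>0 < t\<close> by simp
  then obtain k'' where k'': "k'' \<le> k'" "U k'' = U k + G 1"
    using U_hits[of k "U k + G 1" k'] by auto
  have "G 2 * 1 \<le> G 2 * t" using \<open>0 < t\<close> by (intro mult_left_mono) auto
  moreover have "h * V k'' \<le> h * V k'" using V_mono[OF k''(1)] by simp
  ultimately have "G 2 + h * V k'' \<le> c + h * V k" using cc by linarith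
  then show ?thesis using k'' by blast
qed

lemma repeatedI:
  assumes G: "G \<in> seqs g h" and c: "c < width k" and c': "c' < width k'"
    and k': "U k' = U k + G 1" "c' + G 2 + h * V k' = c + h * V k"
  shows "repeated G (pos k + c)"
proof -
  from G have gp: "0 < G 1" by (auto simp: seqs_def)
  let ?n = "pos k + c" and ?n' = "pos k' + c'"
  have V': "V ?n' = V ?n + G 1" using V_pos[OF c] V_pos[OF c'] k' by simp
  have U': "U ?n' + G 2 = U ?n + g * G 1"
    using U_pos[OF c] U_pos[OF c'] k' by (simp add: algebra_simps)
  have "G 1 * (U ?n' + G 2) = G 1 * (U ?n + g * G 1)" using U' by simp
  then have "val G ?n' = val G ?n"
    using val_eq[OF G, of ?n] val_eq[OF G, of ?n'] V' by (simp add: algebra_simps)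
  moreover have "?n < ?n'" by (rule less_if_V_less) (use V' gp in simp)
  ultimately show ?thesis by (auto simp: repeated_def)
qed

text \<open>For the converse, the required lowest digit \<open>c'\<close> of the partner is determined. Should it be too
  large for the word at \<open>k'\<close>, then \<open>k'\<close> carries \<open>m\<close>, and the next position, with the digit
  \<open>c' - h\<close>, does the job, as two letters \<open>m\<close> are never adjacent.\<close>
lemma repeated_iff_shift:
  assumes G: "G \<in> seqs g h" and c: "c < width k"
  shows "repeated G (pos k + c) \<longleftrightarrow> (\<exists>k'. U k' = U k + G 1 \<and> G 2 + h * V k' \<le> c + h * V k)"
proof
  assume "\<exists>k'. U k' = U k + G 1 \<and> G 2 + h * V k' \<le> c + h * V k"
  then obtain k' where k': "U k' = U k + G 1" "G 2 + h * V k' \<le> c + h * V k" by blast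
  from G have gp: "0 < G 1" "0 < G 2" by (auto simp: seqs_def)
  have less: "k < k'" by (rule less_if_U_less) (use k' gp in simp)
  then have Vle: "V (Suc k) \<le> V k'" by (intro V_mono) simp
  have nw: "\<not> w k"
  proof
    assume "w k"
    then have "h * (V k + 1) \<le> h * V k'" using Vle by (intro mult_left_mono) (auto simp: V_Suc)
    moreover have "c < h" using c \<open>w k\<close> by (simp add: width_def)
    ultimately show False using k' by simp
  qed
  then have cg: "c \<le> g" using c by (simp add: width_def)
  have hV: "h * V k \<le> h * V k'" using less by (intro mult_left_mono V_mono) auto
  (* The lowest digit for which the index pos k' + c' takes the same value. *)
  define c' where "c' = c + h * V k - G 2 - h * V k'"
  have c'eq: "c' + G 2 + h * V k' = c + h * V k" using k' by (simp add: c'_def)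
  have c'g: "c' < g" using c'eq hV cg gp by linarith
  show "repeated G (pos k + c)"
  proof (cases "c' < width k'")
    case True
    then show ?thesis using repeatedI[OF G c True k'(1) c'eq] by simp
  next
    case False
    then have wk': "w k'" "h \<le> c'" using c'g by (auto simp: width_def split: if_splits)
    have "c' - h < width (Suc k')" using not_w_Suc[OF wk'(1)] c'g by (simp add: width_def)
    then show ?thesis
      by (rule repeatedI[OF G c, of _ "Suc k'"]) (use wk' k' c'eq in \<open>auto simp: U_Suc V_Suc\<close>)
  qed
qed (rule repeated_imp_shift[OF assms])

text \<open>Among the positions with \<open>V \<le> V (pos l + e) + j\<close>, the count \<open>U\<close> is largest at the last one,
  which carries \<open>m\<close> and hence closes the word of a letter \<open>p\<close> at some \<open>l'\<close>. So a shift by \<open>a\<close> is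
  possible exactly if it is possible up to there, and \<open>U\<close> hits every value on the way.\<close>
lemma shift_reachable_iff:
  assumes e: "e < width l"
  shows "(\<exists>k'. U k' = U (pos l + e) + a \<and> V k' \<le> V (pos l + e) + j) \<longleftrightarrow>
         (\<exists>l'. U l' = U l + j \<and> \<not> w l' \<and> a + e + h * V l \<le> g + g * j + h * V l')"
    (is "?L \<longleftrightarrow> ?R")
proof
  assume ?L
  then obtain k' where k': "U k' = U (pos l + e) + a" "V k' \<le> V (pos l + e) + j" by blast
  obtain l' where l': "U l' = U l + j" "\<not> w l'" using ex_p_position by blast
  have gl: "g < width l'" using l' by (simp add: width_def)
  have V': "V (Suc (pos l' + g)) = Suc (U l')" using V_pos[OF gl] w_pos[OF gl] l' by (simp add: V_Suc)
  have "k' < Suc (pos l' + g)"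
    by (rule less_if_V_less) (use V' k' l' V_pos[OF e] in simp)
  then have "U k' \<le> U (pos l' + g)" by (intro U_mono) simp
  then have "a + e + h * V l \<le> g + g * j + h * V l'"
    using k' l' U_pos[OF gl] U_pos[OF e] by (simp add: algebra_simps)
  then show ?R using l' by blast
next
  assume ?R
  then obtain l' where l': "U l' = U l + j" "\<not> w l'" "a + e + h * V l \<le> g + g * j + h * V l'" by blast
  have gl: "g < width l'" using l' by (simp add: width_def)
  have "U (pos l + e) + a \<le> U (pos l' + g)"
    using l' U_pos[OF gl] U_pos[OF e] by (simp add: algebra_simps)
  then obtain k' where k': "k' \<le> pos l' + g" "U k' = U (pos l + e) + a"
    using U_hits[of "pos l + e" "U (pos l + e) + a" "pos l' + g"] by auto
  have "V k' \<le> V (pos l + e) + j" using V_mono[OF k'(1)] V_pos[OF gl] V_pos[OF e] l' by simp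
  then show ?L using k' by blast
qed

text \<open>The \<open>j\<close>-th letter \<open>p\<close> after position \<open>pos q + z\<close> is located explicitly. If \<open>q\<close> carries \<open>m\<close>,
  the rest of its word \<open>p\<^sup>h\<close> is followed by at least \<open>g\<close> letters \<open>p\<close>, so no \<open>m\<close> is met. If \<open>q\<close>
  carries \<open>p\<close>, exactly one \<open>m\<close> is met as soon as the end of \<open>p\<^sup>g m\<close> is passed; the fifth case arises
  when the search runs through a whole word \<open>p\<^sup>h\<close> after it.\<close>
lemma V_at_next_p:
  assumes z: "z < width q" and j: "j < g"
    and l': "U l' = U (pos q + z) + j" "\<not> w l'"
  shows "V l' = V (pos q + z) + of_bool (\<not> w q \<and> g \<le> z + j)"
proof -
  have *: ?thesis
    if "y < width k" "w k \<or> y < g" "y + g * U k + h * V k = z + j + g * U q + h * V q"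
       "U k = U q + of_bool (\<not> w q \<and> g \<le> z + j)" for k y
  proof -
    have "\<not> w (pos k + y)" using w_pos[OF that(1)] that(2) by auto
    have "U l' = U (pos k + y)" using l'(1) that(3) U_pos[OF z] U_pos[OF that(1)] by simp
    from this l'(2) \<open>\<not> w (pos k + y)\<close> have "l' = pos k + y" by (rule p_position_unique)
    then show ?thesis using that(4) V_pos[OF z] V_pos[OF that(1)] by simp
  qed
  consider "w q" "z + j < h" | "w q" "h \<le> z + j" | "\<not> w q" "z + j < g"
    | "\<not> w q" "g \<le> z + j" "\<not> w (Suc q) \<or> z + j - g < h"
    | "\<not> w q" "g \<le> z + j" "w (Suc q)" "h \<le> z + j - g" by linarith
  then show ?thesis
  proof cases
    case 1
    then show ?thesis by (intro *[of "z + j" q]) (auto simp: width_def)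
  next
    case 2
    then show ?thesis using z j not_w_Suc[of q]
      by (intro *[of "z + j - h" "Suc q"]) (auto simp: width_def U_Suc V_Suc)
  next
    case 3
    then show ?thesis by (intro *[of "z + j" q]) (auto simp: width_def)
  next
    case 4
    then show ?thesis using z j
      by (intro *[of "z + j - g" "Suc q"]) (auto simp: width_def U_Suc V_Suc)
  next
    case 5
    then show ?thesis using z j not_w_Suc[of "Suc q"]
      by (intro *[of "z + j - g - h" "Suc (Suc q)"]) (auto simp: width_def U_Suc V_Suc)
  qed
qed

text \<open>The two preceding reductions combined. A letter \<open>m\<close> at the first level leaves no room for a
  collision; otherwise \<open>c \<le> g\<close> bounds the number \<open>j\<close> of passed letters by \<open>g - 1\<close>, so that
  \<open>V_at_next_p\<close> applies.\<close>
lemma repeated_iff: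
  assumes G: "G \<in> seqs g h" and z: "z < width q" and e: "e < width (pos q + z)"
    and c: "c < width (pos (pos q + z) + e)"
  shows "repeated G (pos (pos (pos q + z) + e) + c) \<longleftrightarrow>
    \<not> w (pos (pos q + z) + e) \<and> collides g h (G 1) (G 2) (if w q then 0 else z) e c"
proof -
  define l where "l = pos q + z"
  define k where "k = pos l + e"
  from G have gp: "0 < G 1" "0 < G 2" by (auto simp: seqs_def)
  have c': "c < width k" and e': "e < width l" using c e by (auto simp: k_def l_def)
  have "repeated G (pos k + c) \<longleftrightarrow> (\<exists>k'. U k' = U k + G 1 \<and> G 2 + h * V k' \<le> c + h * V k)"
    using repeated_iff_shift[OF G c'] .
  also have "\<dots> \<longleftrightarrow> (\<exists>j. G 2 + h * j \<le> c \<and> (\<exists>k'. U k' = U k + G 1 \<and> V k' \<le> V k + j))" (is "?A \<longleftrightarrow> ?B")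
  proof
    assume ?A
    then obtain k' where k': "U k' = U k + G 1" "G 2 + h * V k' \<le> c + h * V k" by blast
    then have "V k' = V k + (V k' - V k)" using gp less_if_U_less[of k k'] V_mono[of k k'] by auto
    then obtain j where j: "V k' = V k + j" by blast
    then have "G 2 + h * j \<le> c" using k' by (simp add: algebra_simps)
    then show ?B using k'(1) j le_refl by metis
  next
    assume ?B
    then obtain j k' where k': "G 2 + h * j \<le> c" "U k' = U k + G 1" "V k' \<le> V k + j" by blast
    then have "h * V k' \<le> h * (V k + j)" by (intro mult_left_mono) auto
    then have "G 2 + h * V k' \<le> c + h * V k" using k' by (simp add: algebra_simps)
    then show ?A using k' by blast
  qed
  also have "\<dots> \<longleftrightarrow> (\<exists>j. G 2 + h * j \<le> c \<and> (\<exists>l'. U l' = U l + j \<and> \<not> w l' \<and> G 1 + e + h * V l \<le> g + g * j + h * V l'))"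
    unfolding k_def shift_reachable_iff[OF e'] ..
  finally have 1: "repeated G (pos k + c) \<longleftrightarrow>
     (\<exists>j. G 2 + h * j \<le> c \<and> (\<exists>l'. U l' = U l + j \<and> \<not> w l' \<and> G 1 + e + h * V l \<le> g + g * j + h * V l'))" .
  have inner: "(\<exists>l'. U l' = U l + j \<and> \<not> w l' \<and> G 1 + e + h * V l \<le> g + g * j + h * V l') \<longleftrightarrow>
     G 1 + e \<le> g + g * j + h * of_bool (\<not> w q \<and> g \<le> z + j)" if "j < g" for j
  proof -
    obtain l' where l': "U l' = U l + j" "\<not> w l'" using ex_p_position by blast
    have "G 1 + e + h * V l \<le> g + g * j + h * V l'' \<longleftrightarrow>
            G 1 + e \<le> g + g * j + h * of_bool (\<not> w q \<and> g \<le> z + j)"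
      if "U l'' = U l + j" "\<not> w l''" for l''
      using V_at_next_p[OF z \<open>j < g\<close>, folded l_def, OF that] by (simp add: algebra_simps)
    then show ?thesis using l' by blast
  qed
  show ?thesis
  proof (cases "w k")
    case True
    then have "c < h" using c' by (simp add: width_def)
    have le: "\<not> w l \<and> e = g" using w_pos[OF e'] True by (simp add: k_def)
    have "\<not> repeated G (pos k + c)"
    proof
      assume "repeated G (pos k + c)"
      then obtain j where j: "G 2 + h * j \<le> c"
        "\<exists>l'. U l' = U l + j \<and> \<not> w l' \<and> G 1 + e + h * V l \<le> g + g * j + h * V l'" using 1 by blast
      have "h * j < h * 1" using j \<open>c < h\<close> by linarith
      then have "j = 0" by simp
      then have "G 1 + e \<le> g + h * of_bool (\<not> w q \<and> g \<le> z)" using j inner[of 0] g_pos by simp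
      moreover have "\<not> (\<not> w q \<and> g \<le> z)"
        using le w_pos[OF z] z unfolding l_def by (auto simp: width_def)
      ultimately show False using le gp by simp
    qed
    then show ?thesis using True by (simp add: k_def l_def)
  next
    case False
    then have "c \<le> g" using c' by (simp add: width_def)
    have jg: "j < g" if "G 2 + h * j \<le> c" for j
    proof -
      have "1 * j \<le> h * j" using h_pos by (intro mult_right_mono) auto
      then show ?thesis using that \<open>c \<le> g\<close> gp by linarith
    qed
    have "repeated G (pos k + c) \<longleftrightarrow>
      (\<exists>j<g. G 2 + h * j \<le> c \<and> G 1 + e \<le> g + g * j + h * of_bool (\<not> w q \<and> g \<le> z + j))"
      unfolding 1 using inner jg by blast
    also have "\<dots> \<longleftrightarrow> collides g h (G 1) (G 2) (if w q then 0 else z) e c"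
      unfolding collides_def by (intro ex_cong1) auto
    finally show ?thesis using False by (simp add: k_def l_def)
  qed
qed

section \<open>Criteria for unique expansion\<close>

lemma unique_expansion_iff: "unique_expansion g h G \<longleftrightarrow> (\<forall>n. \<not> repeated G n)"
proof -
  have "unique_expansion g h G \<longleftrightarrow> inj (val G)"
    unfolding unique_expansion_def E_all_eq_dig val_def
    using inj_tuple_dig by (auto simp: inj_on_def)
  also have "\<dots> \<longleftrightarrow> (\<forall>n. \<not> repeated G n)"
    unfolding repeated_def inj_def by (metis linorder_neq_iff)
  finally show ?thesis .
qed

lemma pos3_decomp:
  obtains q z e c where "n = pos (pos (pos q + z) + e) + c" "z < width q" "e < width (pos q + z)"
    "c < width (pos (pos q + z) + e)"
  using pos_decomp by metis

text \<open>The weakest form of the cell condition, obtained with \<open>c \<le> g\<close>, \<open>e \<ge> 0\<close> and the last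
  summand present. Each of the sufficient conditions contradicts it.\<close>
lemma repeated_bounds:
  assumes G: "G \<in> seqs g h" and rep: "repeated G n"
  shows "\<exists>j. G 2 + h * j \<le> g \<and> G 1 \<le> g + g * j + h"
proof -
  obtain q z e c where n: "n = pos (pos (pos q + z) + e) + c" and b: "z < width q" "e < width (pos q + z)"
    "c < width (pos (pos q + z) + e)" by (rule pos3_decomp)
  then have *: "\<not> w (pos (pos q + z) + e)" "collides g h (G 1) (G 2) (if w q then 0 else z) e c"
    using repeated_iff[OF G b] rep by auto
  then obtain j where j: "G 2 + h * j \<le> c"
    "G 1 + e \<le> g + g * j + h * of_bool (g \<le> (if w q then 0 else z) + j)" unfolding collides_def by blast
  have "c \<le> g" using b(3) *(1) by (simp add: width_def)
  moreover have "h * of_bool P \<le> h" for P by simp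
  ultimately show ?thesis using j by (meson add_leD1 le_trans add_left_mono)
qed

lemma unique_expansion_criteria:
  assumes G: "G \<in> seqs g h"
    and crit: "G 2 > g * G 1 \<or> G 2 > max g (h - 1) \<or> (g \<le> h - 1 \<and> G 1 > g + h) \<or>
             (g \<ge> h \<and> (real (G 1) > real g * (ell0 g h G + 1) + real h \<or>
                         real (G 1) \<ge> (real g ^ 2 + real g * real h + real h ^ 2) / real h))"
  shows "unique_expansion g h G"
  unfolding unique_expansion_iff
proof (intro allI notI)
  fix n assume "repeated G n"
  then obtain j where j: "G 2 + h * j \<le> g" "G 1 \<le> g + g * j + h"
    using repeated_bounds[OF G] by blast
  from G have gp: "1 \<le> G 1" "1 \<le> G 2" by (auto simp: seqs_def Suc_le_eq)
  define a b x y k where "a = real (G 1)" and "b = real (G 2)" and "x = real g" and "y = real h" and "k = real j"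
  have ge1: "1 \<le> a" "1 \<le> b" "1 \<le> x" "1 \<le> y" "0 \<le> k"
    using gp g_pos h_pos by (auto simp: a_def b_def x_def y_def k_def)
  have jr: "b + y * k \<le> x" "a \<le> x + x * k + y"
    using j by (simp_all add: a_def b_def x_def y_def k_def flip: of_nat_mult of_nat_add)
  consider "G 2 > g * G 1" | "G 2 > g" | "g < h" "G 1 > g + h"
    | "a > x * (ell0 g h G + 1) + y" | "a \<ge> (x ^ 2 + x * y + y ^ 2) / y"
    using crit h_pos by (auto simp: a_def b_def x_def y_def)
  then show False
  proof cases
    case 1
    have "g * 1 \<le> g * G 1" using gp by (intro mult_left_mono) auto
    then show False using 1 j by linarith
  next
    case 2
    then show False using j by simp
  next
    case 3
    then have "0 < j" using j by (cases j) auto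
    then have "h * 1 \<le> h * j" by (intro mult_left_mono) auto
    then show False using 3 j by linarith
  next
    case 4
    define d where "d = x * b + y * a"
    have d: "0 < d" unfolding d_def using ge1 by (intro add_pos_pos mult_pos_pos) auto
    have l: "ell0 g h G = x * (b + a) / d" by (simp add: ell0_def a_def b_def x_def y_def d_def)
    (* The bound on G 1 makes j exceed ell0. With b + y * k <= x this forces
       d < x^2, and then the assumption on a alone is contradictory. *)
    have "x * (ell0 g h G) < x * k" using 4 jr by (simp add: algebra_simps)
    then have "ell0 g h G < k" using ge1 by simp
    then have "x * (b + a) < k * d" using d by (simp add: l pos_divide_less_eq)
    then have "y * (x * (b + a)) < y * (k * d)" using ge1 by simp
    also have "y * (k * d) = (y * k) * d" by simp
    also have "\<dots> \<le> (x - b) * d" using jr d by (intro mult_right_mono) auto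
    finally have "b * (y * x + d) < b * x ^ 2" by (simp add: d_def algebra_simps power2_eq_square)
    then have "y * x + d < x ^ 2" using ge1 by simp
    moreover have "0 < y * x" using ge1 by simp
    ultimately have dx: "d < x ^ 2" by linarith
    have "x * (x * (b + a) / d) \<le> a" using 4 ge1 by (simp add: l algebra_simps)
    then have "x * (x * (b + a)) \<le> a * d" using d by (simp add: field_simps)
    also have "\<dots> < a * x ^ 2" using dx ge1 by (intro mult_strict_left_mono) auto
    finally have "x ^ 2 * b < 0" by (simp add: algebra_simps power2_eq_square)
    moreover have "0 \<le> x ^ 2 * b" using ge1 by simp
    ultimately show False by simp
  next
    case 5
    then have "x ^ 2 + x * y + y ^ 2 \<le> a * y" using ge1 by (simp add: field_simps)
    also have "\<dots> \<le> (x + x * k + y) * y" using jr ge1 by (intro mult_right_mono) auto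
    finally have "x * x \<le> x * (y * k)" by (simp add: algebra_simps power2_eq_square)
    then have "x \<le> y * k" using ge1 by simp
    then show False using jr ge1 by linarith
  qed
qed

end

section \<open>Exact count of repetitions\<close>

lemma sum_lessThan_add: "(\<Sum>n<a + b. F n) = (\<Sum>n<a. F n) + (\<Sum>c<b. F (a + c))"
  for F :: "nat \<Rightarrow> nat"
  by (induction b) auto

context expansions begin

lemma sum_pos: "(\<Sum>n<pos Q. F n) = (\<Sum>k<Q. \<Sum>c<width k. F (pos k + c))" for F :: "nat \<Rightarrow> nat"
  by (induction Q) (auto simp: pos_Suc sum_lessThan_add)

text \<open>The words that arise from the letter at \<open>q\<close> by three substitutions contain a number of repeated
  indices that depends only on this letter.\<close>
lemma repeated_in_cell:
  assumes G: "G \<in> seqs g h"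
  shows "(\<Sum>z<width q. \<Sum>e<width (pos q + z). \<Sum>c<width (pos (pos q + z) + e).
            of_bool (repeated G (pos (pos (pos q + z) + e) + c)))
         = (if w q then cells_m g h (G 1) (G 2) else cells_p g h (G 1) (G 2))"
proof -
  define F :: "nat \<Rightarrow> nat \<Rightarrow> nat \<Rightarrow> nat"
    where "F z e c = of_bool (collides g h (G 1) (G 2) (if w q then 0 else z) e c)" for z e c
  have inner: "(\<Sum>c<width (pos (pos q + z) + e). of_bool (repeated G (pos (pos (pos q + z) + e) + c)))
      = (if w (pos (pos q + z) + e) then 0 else \<Sum>c<Suc g. F z e c)"
    if "z < width q" "e < width (pos q + z)" for z e
    using that repeated_iff[OF G that] by (auto simp: F_def width_def simp del: sum.lessThan_Suc intro!: sum.cong)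
  have "(\<Sum>e<width (pos q + z). \<Sum>c<width (pos (pos q + z) + e). of_bool (repeated G (pos (pos (pos q + z) + e) + c)))
      = (if w (pos q + z) then \<Sum>e<h. \<Sum>c<Suc g. F z e c else \<Sum>e<g. \<Sum>c<Suc g. F z e c)"
    if z: "z < width q" for z
  proof -
    have "(\<Sum>e<width (pos q + z). \<Sum>c<width (pos (pos q + z) + e). of_bool (repeated G (pos (pos (pos q + z) + e) + c)))
      = (\<Sum>e<width (pos q + z). if \<not> w (pos q + z) \<and> e = g then 0 else \<Sum>c<Suc g. F z e c)"
      using inner[OF z] w_pos by (intro sum.cong) (auto simp del: sum.lessThan_Suc)
    also have "\<dots> = (if w (pos q + z) then \<Sum>e<h. \<Sum>c<Suc g. F z e c else \<Sum>e<g. \<Sum>c<Suc g. F z e c)"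
      by (auto simp: width_def intro!: sum.cong)
    finally show ?thesis .
  qed
  then have "(\<Sum>z<width q. \<Sum>e<width (pos q + z). \<Sum>c<width (pos (pos q + z) + e).
            of_bool (repeated G (pos (pos (pos q + z) + e) + c)))
      = (\<Sum>z<width q. if \<not> w q \<and> z = g then \<Sum>e<h. \<Sum>c<Suc g. F z e c else \<Sum>e<g. \<Sum>c<Suc g. F z e c)"
    using w_pos by (intro sum.cong) (auto simp del: sum.lessThan_Suc)
  also have "\<dots> = (if w q then cells_m g h (G 1) (G 2) else cells_p g h (G 1) (G 2))"
  proof (cases "w q")
    case True
    then show ?thesis
      by (simp add: width_def F_def cells_m_def del: sum.lessThan_Suc)
  next
    case False
    then show ?thesis
      by (simp add: width_def F_def cells_p_def sum.lessThan_Suc[of _ g] del: sum.lessThan_Suc)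
  qed
  finally show ?thesis .
qed

definition repeats_below :: "(nat \<Rightarrow> nat) \<Rightarrow> nat \<Rightarrow> nat" where
  "repeats_below G M = card {n. n < M \<and> repeated G n}"

lemma repeats_below_eq_sum: "repeats_below G M = (\<Sum>n<M. of_bool (repeated G n))"
  by (simp add: repeats_below_def of_bool_def sum.If_cases Int_def lessThan_def conj_commute)

lemma repeats_below_mono: "M \<le> N \<Longrightarrow> repeats_below G M \<le> repeats_below G N"
  unfolding repeats_below_def by (rule card_mono) auto

text \<open>The initial segment below \<open>pos (pos (pos Q))\<close> consists of the threefold substituted letters
  before \<open>Q\<close>.\<close>
lemma repeats_below_pos3:
  assumes G: "G \<in> seqs g h"
  shows "repeats_below G (pos (pos (pos Q))) =
           cells_p g h (G 1) (G 2) * U Q + cells_m g h (G 1) (G 2) * V Q"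
proof -
  have "repeats_below G (pos (pos (pos Q))) =
    (\<Sum>q<Q. if w q then cells_m g h (G 1) (G 2) else cells_p g h (G 1) (G 2))"
    unfolding repeats_below_eq_sum sum_pos repeated_in_cell[OF G] ..
  also have "\<dots> = cells_p g h (G 1) (G 2) * U Q + cells_m g h (G 1) (G 2) * V Q"
    by (induction Q) (auto simp: U_Suc V_Suc algebra_simps)
  finally show ?thesis .
qed

lemma cells_eq_0_if_unique:
  assumes G: "G \<in> seqs g h" and uniq: "unique_expansion g h G"
  shows "cells_p g h (G 1) (G 2) = 0" "cells_m g h (G 1) (G 2) = 0"
proof -
  have not: "\<not> repeated G n" for n using uniq by (simp add: unique_expansion_iff)
  (* The index 0 has letter p and the index g has letter m, so every cell of both kinds is met. *)
  have wg: "w (pos 0 + g)" using w_pos[of g 0] by (simp add: width_def)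
  show "cells_p g h (G 1) (G 2) = 0"
    using repeated_in_cell[OF G, of 0] by (simp add: not)
  show "cells_m g h (G 1) (G 2) = 0"
    using repeated_in_cell[OF G, of "pos 0 + g"] wg by (simp add: not)
qed

section \<open>The error term\<close>

abbreviation \<alpha> :: real where "\<alpha> \<equiv> alpha g h"
abbreviation \<beta> :: real where "\<beta> \<equiv> beta g h"

lemma alpha_gt: "1 < \<alpha>" using alpha_gt_1[OF g_pos h_pos] .

lemma alpha_plus_beta: "\<alpha> + \<beta> = real g"
  by (simp add: alpha_def beta_def field_simps)

lemma alpha_sq: "\<alpha>\<^sup>2 = real g * \<alpha> + real h"
proof -
  have "{\<alpha>, \<beta>} \<subseteq> {x. x\<^sup>2 - real g * x - real h = 0}" by (simp only: zeros_char_poly)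
  then show ?thesis by auto
qed

lemma alpha_times_beta: "\<alpha> * \<beta> = - real h"
proof -
  have "\<alpha> * \<alpha> = (\<alpha> + \<beta>) * \<alpha> + real h"
    using alpha_sq by (simp only: alpha_plus_beta power2_eq_square)
  then show ?thesis by (simp add: algebra_simps)
qed

lemma beta_neg: "\<beta> < 0"
proof (rule ccontr)
  assume "\<not> \<beta> < 0"
  then have "0 \<le> \<alpha> * \<beta>" using alpha_gt by simp
  then show False using alpha_times_beta h_pos by simp
qed

lemma beta0_eq: "beta0 g h = - \<beta>"
  using beta_neg by (simp add: beta0_def)

text \<open>The two eigenforms of the substitution, for the eigenvalues \<open>\<beta>\<close> and \<open>\<alpha>\<close>. The first one
  measures how far the ratio of \<open>U n\<close> to \<open>V n\<close> is from \<open>\<alpha>\<close>; the second one is comparable to \<open>n\<close>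
  and is multiplied by exactly \<open>\<alpha>\<close> when a digit 0 is put in front, which makes it the right variable for bounds.\<close>
definition discr :: "nat \<Rightarrow> real" where "discr n = real (U n) - \<alpha> * real (V n)"
definition scale :: "nat \<Rightarrow> real" where "scale n = real (U n) - \<beta> * real (V n)"

lemma discr_0 [simp]: "discr 0 = 0" by (simp add: discr_def)

lemma
  assumes "c < width k"
  shows discr_pos: "discr (pos k + c) = c + \<beta> * discr k"
    and scale_pos: "scale (pos k + c) = c + \<alpha> * scale k"
proof -
  have b: "\<beta> = real g - \<alpha>" using alpha_plus_beta by simp
  have "discr (pos k + c) = c + (real g - \<alpha>) * U k + h * V k"
    unfolding discr_def U_pos[OF assms] V_pos[OF assms] by (simp add: algebra_simps)
  also have "\<dots> = c + \<beta> * U k - (\<alpha> * \<beta>) * V k" by (simp add: b[symmetric] alpha_times_beta)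
  finally show "discr (pos k + c) = c + \<beta> * discr k" by (simp add: discr_def algebra_simps)
  have a: "\<alpha> = real g - \<beta>" using alpha_plus_beta by simp
  have "scale (pos k + c) = c + (real g - \<beta>) * U k + h * V k"
    unfolding scale_def U_pos[OF assms] V_pos[OF assms] by (simp add: algebra_simps)
  also have "\<dots> = c + \<alpha> * U k - (\<alpha> * \<beta>) * V k" by (simp add: a[symmetric] alpha_times_beta)
  finally show "scale (pos k + c) = c + \<alpha> * scale k" by (simp add: scale_def algebra_simps)
qed

lemma
  shows V_eq_discr: "(1 + \<alpha>) * V n = n - discr n"
    and U_eq_discr: "(1 + \<alpha>) * U n = \<alpha> * n + discr n"
proof -
  have n: "real n = real (U n) + real (V n)" by (metis U_plus_V of_nat_add)
  show "(1 + \<alpha>) * V n = n - discr n" "(1 + \<alpha>) * U n = \<alpha> * n + discr n"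
    unfolding n discr_def by (simp_all add: algebra_simps)
qed

text \<open>Deleting the lowest digit divides the index by \<open>\<alpha>\<close> up to discrepancies, since
  \<open>V (pos k + c) = U k\<close>.\<close>
lemma alpha_times_shift:
  assumes "c < width k"
  shows "\<alpha> * k = real (pos k + c) - discr (pos k + c) - discr k"
  using V_eq_discr[of "pos k + c"] U_eq_discr[of k] V_pos[OF assms] by simp

lemma pos_gt: "1 \<le> k \<Longrightarrow> k < pos k"
proof (induction k rule: dec_induct)
  case base
  then show ?case using pos_Suc[of 0] g_pos by (simp add: width_def)
next
  case (step k)
  then show ?case using width_pos[of k] by (simp add: pos_Suc)
qed

lemma scale_ge_1: "1 \<le> n \<Longrightarrow> 1 \<le> scale n"
proof -
  assume "1 \<le> n"
  then have "U 1 \<le> U n" by (rule U_mono)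
  then have "1 \<le> real (U n)" using U_Suc[of 0] by simp
  moreover have "\<beta> * real (V n) \<le> 0" using beta_neg by (simp add: mult_nonpos_nonneg)
  ultimately show ?thesis by (simp add: scale_def)
qed

lemma scale_le: "scale n \<le> (1 + beta0 g h) * n"
proof -
  have n: "real n = real (U n) + real (V n)" by (metis U_plus_V of_nat_add)
  have "\<beta> * real (U n) \<le> 0" using beta_neg by (simp add: mult_nonpos_nonneg)
  then have "\<beta> * real (U n) \<le> real (V n)" by (rule order_trans) simp
  then show ?thesis unfolding n scale_def beta0_eq by (simp add: algebra_simps)
qed

text \<open>From \<open>discr (pos k + c) = c + \<beta> * discr k\<close> and digits at most \<open>g + h\<close>, any function \<open>\<phi>\<close>
  of the scale that survives one digit step bounds the discrepancy.\<close>
lemma abs_discr_le_potential: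
  fixes \<phi> :: "real \<Rightarrow> real"
  assumes mono: "\<And>x y. 1 \<le> x \<Longrightarrow> x \<le> y \<Longrightarrow> \<phi> x \<le> \<phi> y"
    and base: "real (g + h) \<le> \<phi> 1"
    and step: "\<And>x. 1 \<le> x \<Longrightarrow> real (g + h) + beta0 g h * \<phi> x \<le> \<phi> (\<alpha> * x)"
    and n: "1 \<le> n"
  shows "\<bar>discr n\<bar> \<le> \<phi> ((1 + beta0 g h) * n)"
proof -
  have "\<bar>discr n\<bar> \<le> \<phi> (scale n)" using n
  proof (induction n rule: less_induct)
    case (less n)
    obtain k c where kc: "n = pos k + c" "c < width k" using pos_decomp by blast
    have c: "real c \<le> real (g + h)" using kc(2) by (auto simp: width_def split: if_splits)
    show ?case
    proof (cases "k = 0")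
      case True
      then have "\<bar>discr n\<bar> \<le> \<phi> 1" using discr_pos[OF kc(2)] c base kc by simp
      then show ?thesis using mono[OF order_refl scale_ge_1[OF less.prems]] by simp
    next
      case False
      then have "k < n" using pos_gt[of k] kc by simp
      then have IH: "\<bar>discr k\<bar> \<le> \<phi> (scale k)" using less.IH False by simp
      have s: "1 \<le> scale k" using scale_ge_1 False by simp
      have "\<bar>discr n\<bar> \<le> c + \<bar>\<beta>\<bar> * \<bar>discr k\<bar>"
        unfolding kc discr_pos[OF kc(2)] by (metis abs_mult abs_of_nat abs_triangle_ineq)
      also have "\<dots> \<le> real (g + h) + beta0 g h * \<phi> (scale k)"
        using c IH by (intro add_mono mult_mono) (auto simp: beta0_def)
      also have "\<dots> \<le> \<phi> (\<alpha> * scale k)" using step[OF s] .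
      also have "\<dots> \<le> \<phi> (scale n)"
      proof (rule mono)
        have "1 * 1 \<le> \<alpha> * scale k" using alpha_gt s by (intro mult_mono) auto
        then show "1 \<le> \<alpha> * scale k" by simp
        show "\<alpha> * scale k \<le> scale n" using scale_pos[OF kc(2)] kc(1) by simp
      qed
      finally show ?thesis .
    qed
  qed
  also have "\<dots> \<le> \<phi> ((1 + beta0 g h) * n)" using mono[OF scale_ge_1[OF n] scale_le] .
  finally show ?thesis .
qed

text \<open>A function that dominates the discrepancy and has the order of the error term. It is preferred
  to the error term because it is at least 1 everywhere, so that inequalities hold for all indices
  and not just eventually.\<close>
definition error_gauge :: "(nat \<Rightarrow> real) \<Rightarrow> bool" where
  "error_gauge \<eta> \<longleftrightarrow> mono \<eta> \<and> (\<forall>n. 1 \<le> \<eta> n) \<and> (\<forall>a. \<exists>C. \<forall>n. \<eta> (a * n) \<le> C * \<eta> n) \<and>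
     (\<exists>C. \<forall>n. \<bar>discr n\<bar> \<le> C * \<eta> n) \<and> \<eta> \<in> O(err g h)"

lemma error_gaugeI:
  assumes "mono \<eta>" "\<And>n. 1 \<le> \<eta> n" "\<And>a. \<exists>C. \<forall>n. \<eta> (a * n) \<le> C * \<eta> n"
    "\<And>n. 1 \<le> n \<Longrightarrow> \<bar>discr n\<bar> \<le> C * \<eta> n" "\<eta> \<in> O(err g h)"
  shows "error_gauge \<eta>"
proof -
  have "\<bar>discr n\<bar> \<le> C * \<eta> n" if "0 \<le> C" for n
    using assms(4)[of n] that order_trans[OF zero_le_one assms(2)[of n]] by (cases n) auto
  moreover have "0 \<le> C"
  proof -
    have "0 \<le> C * \<eta> 1" using assms(4)[of 1] by linarith
    then show ?thesis using assms(2)[of 1] by (simp add: zero_le_mult_iff)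
  qed
  ultimately show ?thesis using assms unfolding error_gauge_def by blast
qed

text \<open>The potentials are the constant \<open>K / (1 - \<beta>\<^sub>0)\<close>, the function \<open>K * (1 + log\<^sub>\<alpha> x)\<close>, and
  \<open>(K + B) * x powr \<gamma> - B\<close>, where \<open>\<alpha> powr \<gamma> = \<beta>\<^sub>0\<close> and \<open>B\<close> is chosen with \<open>K + B = \<beta>\<^sub>0 * B\<close> to absorb
  the added digit.\<close>
lemma ex_error_gauge: "\<exists>\<eta>. error_gauge \<eta>"
proof -
  let ?b = "beta0 g h"
  have b0: "0 < ?b" using beta_neg by (simp add: beta0_eq)
  define K where "K = real g + real h"
  have K: "0 < K" using g_pos by (simp add: K_def)
  consider "?b < 1" | "?b = 1" | "1 < ?b" by linarith
  then show ?thesis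
  proof cases
    case 1
    have "error_gauge (\<lambda>_. 1)"
    proof (rule error_gaugeI)
      show "\<exists>C. \<forall>n::nat. (1::real) \<le> C * 1" by (intro exI[of _ 1]) auto
      show "(\<lambda>_. 1) \<in> O(err g h)" using 1 by (simp add: err_def[abs_def])
      show "\<bar>discr n\<bar> \<le> K / (1 - ?b) * 1" if "1 \<le> n" for n
        unfolding mult_1_right
      proof (rule abs_discr_le_potential[OF _ _ _ that, of "\<lambda>_. K / (1 - ?b)"])
        have "K * (1 - ?b) \<le> K" using K b0 by (simp add: algebra_simps)
        then show "real (g + h) \<le> K / (1 - ?b)" using 1 by (simp add: K_def[symmetric] pos_le_divide_eq)
        show "real (g + h) + ?b * (K / (1 - ?b)) \<le> K / (1 - ?b)"
          using 1 by (simp add: K_def[symmetric] field_simps)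
      qed auto
    qed (auto simp: mono_def)
    then show ?thesis by blast
  next
    case 2
    have l\<alpha>: "0 < ln \<alpha>" using alpha_gt by simp
    have "error_gauge (\<lambda>n. 1 + ln (real n + 1))"
    proof (rule error_gaugeI)
      fix a :: nat
      have "1 + ln (real (a * n) + 1) \<le> (1 + ln (real a + 1)) * (1 + ln (real n + 1))" for n
      proof -
        have "ln (real (a * n) + 1) \<le> ln ((real a + 1) * (real n + 1))"
        proof (subst ln_le_cancel_iff)
          show "0 < real (a * n) + 1" by (rule add_nonneg_pos) auto
          show "0 < (real a + 1) * (real n + 1)" by (intro mult_pos_pos add_nonneg_pos) auto
          show "real (a * n) + 1 \<le> (real a + 1) * (real n + 1)" by (simp add: algebra_simps)
        qed
        also have "\<dots> = ln (real a + 1) + ln (real n + 1)" by (simp add: ln_mult)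
        finally have "ln (real (a * n) + 1) \<le> ln (real a + 1) + ln (real n + 1)" .
        moreover have "0 \<le> ln (real a + 1) * ln (real n + 1)" by (intro mult_nonneg_nonneg) auto
        moreover have "(1 + ln (real a + 1)) * (1 + ln (real n + 1)) =
            1 + ln (real a + 1) + ln (real n + 1) + ln (real a + 1) * ln (real n + 1)"
          by (simp only: distrib_left distrib_right mult_1_left mult_1_right add.assoc add.left_commute)
        ultimately show ?thesis by linarith
      qed
      then show "\<exists>C. \<forall>n. 1 + ln (real (a * n) + 1) \<le> C * (1 + ln (real n + 1))" by blast
    next
      fix n :: nat assume n: "1 \<le> n"
      have "\<bar>discr n\<bar> \<le> K * (1 + ln ((1 + ?b) * n) / ln \<alpha>)"
      proof (rule abs_discr_le_potential[OF _ _ _ n, of "\<lambda>x. K * (1 + ln x / ln \<alpha>)"])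
        fix x :: real assume x: "1 \<le> x"
        have "ln (\<alpha> * x) = ln \<alpha> + ln x" using x alpha_gt by (simp add: ln_mult)
        then show "real (g + h) + ?b * (K * (1 + ln x / ln \<alpha>)) \<le> K * (1 + ln (\<alpha> * x) / ln \<alpha>)"
          using 2 l\<alpha> by (simp add: K_def[symmetric] add_divide_distrib algebra_simps)
        fix y :: real assume "x \<le> y"
        then show "K * (1 + ln x / ln \<alpha>) \<le> K * (1 + ln y / ln \<alpha>)"
          using K l\<alpha> x by (intro mult_left_mono add_mono divide_right_mono) auto
      qed (simp add: K_def)
      also have "\<dots> \<le> K * ((1 + 1 / ln \<alpha>) * (1 + ln (real n + 1)))"
      proof (rule mult_left_mono)
        have "ln ((1 + ?b) * n) = ln 2 + ln n" using n 2 by (simp add: ln_mult)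
        also have "\<dots> \<le> 1 + ln (real n + 1)"
          using n ln_le_minus_one[of 2] by (intro add_mono) auto
        finally have "ln ((1 + ?b) * n) / ln \<alpha> \<le> (1 + ln (real n + 1)) / ln \<alpha>"
          using l\<alpha> by (intro divide_right_mono) auto
        moreover have "0 \<le> ln (real n + 1)" by simp
        moreover have "(1 + 1 / ln \<alpha>) * (1 + ln (real n + 1)) =
            1 + ln (real n + 1) + (1 + ln (real n + 1)) / ln \<alpha>"
          by (simp add: algebra_simps add_divide_distrib)
        ultimately show "1 + ln ((1 + ?b) * n) / ln \<alpha> \<le> (1 + 1 / ln \<alpha>) * (1 + ln (real n + 1))"
          by linarith
      qed (use K in simp)
      finally show "\<bar>discr n\<bar> \<le> (K * (1 + 1 / ln \<alpha>)) * (1 + ln (real n + 1))" by (simp only: mult.assoc)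
    next
      have "eventually (\<lambda>n::nat. norm (1 + ln (real n + 1)) \<le> 3 * norm (err g h n)) at_top"
        using eventually_ge_at_top[of 3]
      proof eventually_elim
        case (elim n)
        have "ln (real n + 1) \<le> ln (2 * real n)" using elim by simp
        also have "\<dots> = ln 2 + ln n" using elim by (simp add: ln_mult)
        also have "\<dots> \<le> 2 * ln n" using elim by simp
        finally have "ln (real n + 1) \<le> 2 * ln n" .
        moreover have "ln (exp 1) \<le> ln (real n)" using elim exp_le by (subst ln_le_cancel_iff) auto
        ultimately show ?case using 2 by (simp add: err_def)
      qed
      then show "(\<lambda>n. 1 + ln (real n + 1)) \<in> O(err g h)" by (rule bigoI)
    qed (auto intro!: monoI)
    then show ?thesis by blast
  next
    case 3
    define \<gamma> where "\<gamma> = log \<alpha> ?b"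
    have \<gamma>: "0 < \<gamma>" "\<alpha> powr \<gamma> = ?b" using 3 alpha_gt by (auto simp: \<gamma>_def)
    define B where "B = K / (?b - 1)"
    have B: "0 < B" "K + B = ?b * B" using 3 K by (auto simp: B_def field_simps)
    have "error_gauge (\<lambda>n. (real n + 1) powr \<gamma>)"
    proof (rule error_gaugeI)
      fix a :: nat
      have "(real (a * n) + 1) powr \<gamma> \<le> (real a + 1) powr \<gamma> * (real n + 1) powr \<gamma>" for n
      proof -
        have "(real (a * n) + 1) powr \<gamma> \<le> ((real a + 1) * (real n + 1)) powr \<gamma>"
          using \<gamma> by (intro powr_mono2) (auto simp: algebra_simps)
        then show ?thesis by (simp add: powr_mult)
      qed
      then show "\<exists>C. \<forall>n. (real (a * n) + 1) powr \<gamma> \<le> C * (real n + 1) powr \<gamma>" by blast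
    next
      fix n :: nat assume n: "1 \<le> n"
      have "\<bar>discr n\<bar> \<le> (K + B) * ((1 + ?b) * n) powr \<gamma> - B"
      proof (rule abs_discr_le_potential[OF _ _ _ n, of "\<lambda>x. (K + B) * x powr \<gamma> - B"])
        fix x :: real assume x: "1 \<le> x"
        have "(\<alpha> * x) powr \<gamma> = ?b * x powr \<gamma>" using x alpha_gt \<gamma> by (simp add: powr_mult)
        then show "real (g + h) + ?b * ((K + B) * x powr \<gamma> - B) \<le> (K + B) * (\<alpha> * x) powr \<gamma> - B"
          using B(2) by (simp add: K_def[symmetric] algebra_simps)
        fix y :: real assume "x \<le> y"
        then show "(K + B) * x powr \<gamma> - B \<le> (K + B) * y powr \<gamma> - B"
          using K B \<gamma> x by (intro diff_right_mono mult_left_mono powr_mono2) auto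
      qed (simp add: K_def)
      also have "\<dots> \<le> (K + B) * (((1 + ?b) * (real n + 1)) powr \<gamma>)"
        using B K b0 \<gamma> by (intro order_trans[OF diff_left_mono[of 0 B]]) (auto intro!: mult_left_mono powr_mono2)
      also have "\<dots> = ((K + B) * (1 + ?b) powr \<gamma>) * (real n + 1) powr \<gamma>"
        using b0 by (simp add: powr_mult)
      finally show "\<bar>discr n\<bar> \<le> ((K + B) * (1 + ?b) powr \<gamma>) * (real n + 1) powr \<gamma>" .
    next
      have "eventually (\<lambda>n::nat. norm ((real n + 1) powr \<gamma>) \<le> 2 powr \<gamma> * norm (err g h n)) at_top"
        using eventually_ge_at_top[of 1]
      proof eventually_elim
        case (elim n)
        have "(real n + 1) powr \<gamma> \<le> (2 * real n) powr \<gamma>" using elim \<gamma> by (intro powr_mono2) auto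
        then show ?case using 3 by (simp add: err_def powr_mult \<gamma>_def)
      qed
      then show "(\<lambda>n. (real n + 1) powr \<gamma>) \<in> O(err g h)" by (rule bigoI)
    qed (use \<gamma> in \<open>auto intro!: monoI powr_mono2 ge_one_powr_ge_zero\<close>)
    then show ?thesis by blast
  qed
qed

end

section \<open>Asymptotics\<close>

lemma card_near_le:
  fixes x T :: real
  assumes "0 \<le> T" and "\<And>n. n \<in> S \<Longrightarrow> \<bar>real n - x\<bar> \<le> T"
  shows "finite S" "real (card S) \<le> 2 * T + 1"
proof -
  have sub: "int ` S \<subseteq> {\<lceil>x - T\<rceil>..\<lfloor>x + T\<rfloor>}"
  proof
    fix i assume "i \<in> int ` S"
    then obtain n where n: "i = int n" "n \<in> S" by auto
    have "x - T \<le> real_of_int i" "real_of_int i \<le> x + T"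
      using assms(2)[OF n(2)] n(1) by (auto simp: abs_le_iff)
    then show "i \<in> {\<lceil>x - T\<rceil>..\<lfloor>x + T\<rfloor>}" by (auto simp: ceiling_le_iff le_floor_iff)
  qed
  then have fin: "finite (int ` S)" by (rule finite_subset) simp
  then show "finite S" by (rule finite_imageD) (simp add: inj_on_def)
  have "card S = card (int ` S)" by (simp add: card_image inj_on_def)
  also have "\<dots> \<le> card {\<lceil>x - T\<rceil>..\<lfloor>x + T\<rfloor>}" using sub by (intro card_mono) auto
  finally have "card S \<le> nat (\<lfloor>x + T\<rfloor> - \<lceil>x - T\<rceil> + 1)" by simp
  moreover have "real_of_int \<lfloor>x + T\<rfloor> \<le> x + T" "x - T \<le> real_of_int \<lceil>x - T\<rceil>" by auto
  ultimately show "real (card S) \<le> 2 * T + 1" using assms(1) by linarith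
qed

lemma card_diff_le_card_sym_diff:
  assumes "finite A" "finite B"
  shows "\<bar>real (card A) - real (card B)\<bar> \<le> real (card ((A - B) \<union> (B - A)))"
proof -
  have "card A \<le> card (B \<union> ((A - B) \<union> (B - A)))" using assms by (intro card_mono) auto
  moreover have "card B \<le> card (A \<union> ((A - B) \<union> (B - A)))" using assms by (intro card_mono) auto
  ultimately show ?thesis
    using card_Un_le[of A "(A - B) \<union> (B - A)"] card_Un_le[of B "(A - B) \<union> (B - A)"] by linarith
qed

context expansions begin

text \<open>Up to the factor \<open>1 + \<alpha>\<close>, the average increase of the value per index.\<close>
definition slope :: "(nat \<Rightarrow> nat) \<Rightarrow> real" where
  "slope G = \<alpha> * G 1 + G 2 - g * G 1"

lemma alpha_slope: "\<alpha> * slope G = G 2 * \<alpha> + h * G 1"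
proof -
  have "\<alpha> * slope G = \<alpha>\<^sup>2 * G 1 + \<alpha> * G 2 - \<alpha> * g * G 1"
    by (simp add: slope_def algebra_simps power2_eq_square)
  then show ?thesis unfolding alpha_sq by (simp add: algebra_simps)
qed

lemma slope_pos: "G \<in> seqs g h \<Longrightarrow> 0 < slope G"
proof -
  assume "G \<in> seqs g h"
  then have "0 < real (G 2)" by (simp add: seqs_def)
  then have "0 < \<alpha> * slope G" unfolding alpha_slope using alpha_gt by (intro add_pos_nonneg) auto
  then show ?thesis using alpha_gt by (simp add: zero_less_mult_iff)
qed

lemma r_const_eq: "r_const g h G = (1 + \<alpha>) / slope G"
proof -
  have "(real g + 1) * \<alpha> + real h = \<alpha> * (1 + \<alpha>)"
    using alpha_sq by (simp add: algebra_simps power2_eq_square)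
  then have "r_const g h G = (\<alpha> * (1 + \<alpha>)) / (\<alpha> * slope G)"
    unfolding r_const_def alpha_slope by simp
  then show ?thesis using alpha_gt by simp
qed

lemma r_const_pos: "G \<in> seqs g h \<Longrightarrow> 0 < r_const g h G"
  using slope_pos alpha_gt by (simp add: r_const_eq)

text \<open>The value is a linear form in \<open>U n\<close> and \<open>V n\<close>, hence in \<open>n = U n + V n\<close> and \<open>discr n\<close>.\<close>
lemma val_discr:
  assumes G: "G \<in> seqs g h"
  shows "n = r_const g h G * val G n - (real (G 1) - G 2 + g * G 1) / slope G * discr n"
proof -
  have "real (val G n) + g * G 1 * V n = G 1 * U n + G 2 * V n"
    using arg_cong[OF val_eq[OF G, of n], of real] by simp
  then have val: "real (val G n) = G 1 * U n + (real (G 2) - g * G 1) * V n"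
    by (simp add: algebra_simps)
  have "(1 + \<alpha>) * real (val G n) = G 1 * ((1 + \<alpha>) * U n) + (real (G 2) - g * G 1) * ((1 + \<alpha>) * V n)"
    unfolding val by (simp add: algebra_simps)
  also have "\<dots> = slope G * n + (real (G 1) - G 2 + g * G 1) * discr n"
    unfolding V_eq_discr U_eq_discr slope_def by (simp add: algebra_simps)
  finally have "(1 + \<alpha>) * real (val G n) = slope G * n + (real (G 1) - G 2 + g * G 1) * discr n" .
  then have "real n = ((1 + \<alpha>) * real (val G n) - (real (G 1) - G 2 + g * G 1) * discr n) / slope G"
    using slope_pos[OF G] by (simp add: eq_divide_eq mult.commute)
  then show ?thesis unfolding r_const_eq by (simp add: diff_divide_distrib)
qed

text \<open>Comparison with \<open>H\<close>, whose initial values exceed those of \<open>G\<close> at most by the factor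
  \<open>g + 1\<close>. In particular each value is taken only finitely often.\<close>
lemma val_ge:
  assumes G: "G \<in> seqs g h"
  shows "n \<le> (g + 1) * val G n"
proof -
  have H_le: "1 \<le> k \<Longrightarrow> H k \<le> (g + 1) * G k" for k
  proof (induction k rule: H.induct)
    case (4 k)
    have "G (Suc (Suc (Suc k))) = g * G (Suc (Suc k)) + h * G (Suc k)"
      using G by (auto simp: seqs_def)
    moreover have "g * H (Suc (Suc k)) + h * H (Suc k)
        \<le> g * ((g + 1) * G (Suc (Suc k))) + h * ((g + 1) * G (Suc k))"
      using 4 by (intro add_mono mult_left_mono) auto
    ultimately show ?case by (simp add: algebra_simps)
  next
    case 2
    then show ?case using G by (auto simp: seqs_def Suc_le_eq)
  next
    case 3
    have "1 \<le> G 2" using G by (auto simp: seqs_def Suc_le_eq)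
    then have "(g + 1) * 1 \<le> (g + 1) * G 2" by (intro mult_left_mono) auto
    then show ?case by (simp add: numeral_2_eq_2)
  qed auto
  have "n = dot (tuple_of (dig n)) H" by (simp add: dot_dig_H)
  also have "\<dots> \<le> (\<Sum>i<length (dig n). dig n ! i * ((g + 1) * G (Suc i)))"
    unfolding dot_tuple_of by (intro sum_mono mult_left_mono H_le) auto
  also have "\<dots> = (g + 1) * val G n"
    by (simp add: val_def dot_tuple_of sum_distrib_left mult_ac del: mult_Suc mult_Suc_right)
  finally show ?thesis .
qed

lemma card_R_upto:
  assumes G: "G \<in> seqs g h"
  shows "card (R_upto g h G X) = card {n. \<not> repeated G n \<and> 1 \<le> val G n \<and> val G n \<le> X}"
proof -
  let ?S = "{n. \<not> repeated G n \<and> 1 \<le> val G n \<and> val G n \<le> X}"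
  have "inj_on (val G) ?S"
    unfolding inj_on_def repeated_def by (metis (mono_tags, lifting) linorder_neq_iff mem_Collect_eq)
  moreover have "val G ` ?S = R_upto g h G X"
  proof -
    have "\<exists>n. \<not> repeated G n \<and> val G n = val G m" for m
    proof -
      let ?T = "{n. val G n = val G m}"
      have "?T \<subseteq> {..(g + 1) * val G m}" 
      proof
        fix n assume "n \<in> ?T"
        then show "n \<in> {..(g + 1) * val G m}" using val_ge[OF G, of n] by simp
      qed
      then have fin: "finite ?T" by (rule finite_subset) simp
      then have "Max ?T \<in> ?T" by (intro Max_in) auto
      moreover have "\<not> repeated G (Max ?T)"
        using Max_ge[OF fin] \<open>Max ?T \<in> ?T\<close> by (force simp: repeated_def)
      ultimately show ?thesis by blast
    qed
    moreover have "R_upto g h G X = {x. 1 \<le> x \<and> x \<le> X \<and> (\<exists>m. x = val G m)}"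
      by (auto simp: R_upto_def R_def E_all_eq_dig val_def)
    ultimately show ?thesis by (auto simp: image_iff) metis
  qed
  ultimately show ?thesis by (metis card_image)
qed

text \<open>Below \<open>M\<close>, count the repetitions up to the threefold substituted letter that contains \<open>M\<close>. Its
  index \<open>Q\<close> is \<open>\<omega>\<^sup>3 * M\<close> up to discrepancies, and the two letters have frequencies
  \<open>1 / (1 + \<omega>)\<close> and \<open>\<omega> / (1 + \<omega>)\<close>.\<close>
lemma repeats_below_asymp:
  assumes G: "G \<in> seqs g h" and \<eta>: "error_gauge \<eta>"
  defines "\<theta> \<equiv> (cells_p g h (G 1) (G 2) * omega g h ^ 3 + cells_m g h (G 1) (G 2) * omega g h ^ 4) / (1 + omega g h)"
  shows "\<exists>C. \<forall>M. \<bar>real (repeats_below G M) - \<theta> * M\<bar> \<le> C * \<eta> M"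
proof -
  obtain D where D: "\<And>n. \<bar>discr n\<bar> \<le> D * \<eta> n" and \<eta>1: "\<And>n. 1 \<le> \<eta> n" and mono: "mono \<eta>"
    using \<eta> unfolding error_gauge_def by blast
  have D0: "0 \<le> D"
  proof -
    have "0 \<le> D * \<eta> 0" using D[of 0] by linarith
    then show ?thesis using \<eta>1[of 0] by (simp add: zero_le_mult_iff)
  qed
  define p q where "p = real (cells_p g h (G 1) (G 2))" and "q = real (cells_m g h (G 1) (G 2))"
  define \<omega> where "\<omega> = omega g h"
  have \<omega>: "0 < \<omega>" "\<omega> \<le> 1" "\<alpha> * \<omega> = 1" "\<alpha> = 1 / \<omega>" using alpha_gt by (auto simp: \<omega>_def omega_def)
  have "\<bar>real (repeats_below G M) - \<theta> * M\<bar> \<le> ((p + q) * (7 * D + 1)) * \<eta> M" for M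
  proof -
    obtain k c where k: "M = pos k + c" "c < width k" using pos_decomp by blast
    obtain l e where l: "k = pos l + e" "e < width l" using pos_decomp by blast
    obtain Q z where Q: "l = pos Q + z" "z < width Q" using pos_decomp by blast
    define d where "d = D * \<eta> M"
    have le: "Q \<le> l" "l \<le> k" "k \<le> M" using pos_ge[of Q] pos_ge[of l] pos_ge[of k] k l Q by auto
    have bnd: "\<bar>discr n\<bar> \<le> d" if "n \<le> M" for n
      using order_trans[OF D mult_left_mono[OF monoD[OF mono that] D0]] by (simp add: d_def)
    have shift: "\<bar>j' - \<omega> * j\<bar> \<le> 2 * d"
      if "\<alpha> * real j' = real j - discr j - discr j'" "j \<le> M" "j' \<le> M" for j j' :: nat
    proof -
      have "real j' = \<omega> * (\<alpha> * real j')" using \<omega>(3) by (simp add: mult.assoc[symmetric] mult.commute[of \<omega>])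
      then have "real j' - \<omega> * real j = \<omega> * (- discr j - discr j')" unfolding that(1) by (simp add: algebra_simps)
      then have "\<bar>real j' - \<omega> * real j\<bar> = \<omega> * \<bar>discr j + discr j'\<bar>"
        using \<omega> by (simp add: abs_mult abs_minus_commute)
      also have "\<dots> \<le> 1 * \<bar>discr j + discr j'\<bar>" using \<omega> by (intro mult_right_mono) auto
      also have "\<dots> \<le> 2 * d"
        using abs_triangle_ineq[of "discr j" "discr j'"] bnd[OF that(2)] bnd[OF that(3)] by simp
      finally show ?thesis .
    qed
    have contract: "\<bar>\<omega> * x\<bar> \<le> \<bar>x\<bar>" for x using \<omega> by (simp add: abs_mult mult_left_le_one_le)
    have 1: "\<bar>k - \<omega> * M\<bar> \<le> 2 * d" using shift[of k M] alpha_times_shift[OF k(2)] k(1) le by simp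
    have 2: "\<bar>l - \<omega> * k\<bar> \<le> 2 * d" using shift[of l k] alpha_times_shift[OF l(2)] l(1) le by simp
    have 3: "\<bar>Q - \<omega> * l\<bar> \<le> 2 * d" using shift[of Q l] alpha_times_shift[OF Q(2)] Q(1) le by simp
    have l2: "\<bar>l - \<omega> ^ 2 * M\<bar> \<le> 4 * d"
      using 1 2 contract[of "k - \<omega> * M"] by (simp add: power2_eq_square algebra_simps)
    have l3: "\<bar>Q - \<omega> ^ 3 * M\<bar> \<le> 6 * d"
      using l2 3 contract[of "l - \<omega> ^ 2 * M"] by (simp add: power2_eq_square power3_eq_cube algebra_simps)
    have QM: "Q \<le> M" using le by simp
    have sc: "\<bar>x\<bar> \<le> y" if "(1 + \<alpha>) * x = z" "\<bar>z\<bar> \<le> (1 + \<alpha>) * y" for x y z :: real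
    proof -
      have "(1 + \<alpha>) * \<bar>x\<bar> = \<bar>z\<bar>" using alpha_gt by (simp add: abs_mult flip: that(1))
      then have "(1 + \<alpha>) * \<bar>x\<bar> \<le> (1 + \<alpha>) * y" using that(2) by simp
      then show ?thesis using alpha_gt by simp
    qed
    have d0: "0 \<le> d" using bnd[of M] by linarith
    have r1: "(1 + \<alpha>) * (\<omega> ^ 3 / (1 + \<omega>)) = \<alpha> * \<omega> ^ 3" using \<omega> by (simp add: field_simps)
    have r2: "(1 + \<alpha>) * (\<omega> ^ 4 / (1 + \<omega>)) = \<omega> ^ 3" using \<omega> by (simp add: field_simps eval_nat_numeral)
    have Ub: "\<bar>U Q - \<omega> ^ 3 / (1 + \<omega>) * M\<bar> \<le> 7 * d"
    proof (rule sc)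
      show "(1 + \<alpha>) * (U Q - \<omega> ^ 3 / (1 + \<omega>) * M) = \<alpha> * (Q - \<omega> ^ 3 * M) + discr Q"
        unfolding right_diff_distrib U_eq_discr mult.assoc[symmetric] r1 by (simp add: algebra_simps)
      have "\<bar>\<alpha> * (Q - \<omega> ^ 3 * M)\<bar> \<le> \<alpha> * (6 * d)"
        using l3 alpha_gt by (simp add: abs_mult)
      moreover have "\<bar>discr Q\<bar> \<le> d" using bnd[OF QM] .
      moreover have "0 \<le> \<alpha> * d" using d0 alpha_gt by simp
      ultimately show "\<bar>\<alpha> * (Q - \<omega> ^ 3 * M) + discr Q\<bar> \<le> (1 + \<alpha>) * (7 * d)"
        using d0 by (simp add: algebra_simps)
    qed
    have Vb: "\<bar>V Q - \<omega> ^ 4 / (1 + \<omega>) * M\<bar> \<le> 7 * d"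
    proof (rule sc)
      show "(1 + \<alpha>) * (V Q - \<omega> ^ 4 / (1 + \<omega>) * M) = (Q - \<omega> ^ 3 * M) - discr Q"
        unfolding right_diff_distrib V_eq_discr mult.assoc[symmetric] r2 by (simp add: algebra_simps)
      have "\<bar>discr Q\<bar> \<le> d" using bnd[OF QM] .
      moreover have "0 \<le> \<alpha> * d" using d0 alpha_gt by simp
      ultimately show "\<bar>(Q - \<omega> ^ 3 * M) - discr Q\<bar> \<le> (1 + \<alpha>) * (7 * d)"
        using l3 d0 unfolding distrib_right by linarith
    qed
    have "pos (pos (pos Q)) \<le> M" "M \<le> pos (pos (pos (Suc Q)))"
    proof -
      have mono_pos: "mono pos" by (rule mono_iff_le_Suc[THEN iffD2]) (simp add: pos_Suc)
      show "pos (pos (pos Q)) \<le> M"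
        using monoD[OF mono_pos, of "pos (pos Q)" k] monoD[OF mono_pos, of "pos Q" l] k l Q by simp
      have s: "pos a + b \<le> pos n" if "Suc a \<le> n" "b < width a" for a b n
        using monoD[OF mono_pos that(1)] that(2) by (simp add: pos_Suc)
      have "Suc l \<le> pos (Suc Q)" using Q by (simp add: pos_Suc)
      then have "Suc k \<le> pos (pos (Suc Q))"
        using monoD[OF mono_pos, of "Suc l"] l by (fastforce simp: pos_Suc)
      then show "M \<le> pos (pos (pos (Suc Q)))" using s k by simp
    qed
    from this[THEN repeats_below_mono[of _ _ G]]
    have "real (repeats_below G (pos (pos (pos Q)))) \<le> repeats_below G M"
      "real (repeats_below G M) \<le> repeats_below G (pos (pos (pos (Suc Q))))" by simp_all
    then have low: "p * U Q + q * V Q \<le> repeats_below G M"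
      and high: "repeats_below G M \<le> p * U (Suc Q) + q * V (Suc Q)"
      unfolding repeats_below_pos3[OF G] p_def q_def by simp_all
    have pq: "0 \<le> p" "0 \<le> q" by (simp_all add: p_def q_def)
    have "p * U (Suc Q) \<le> p * (U Q + 1)" "q * V (Suc Q) \<le> q * (V Q + 1)"
      using pq by (intro mult_left_mono; simp add: U_Suc V_Suc)+
    then have A: "\<bar>repeats_below G M - (p * U Q + q * V Q)\<bar> \<le> p + q"
      using low high by (simp add: algebra_simps)
    have \<theta>: "\<theta> * M = p * (\<omega> ^ 3 / (1 + \<omega>) * M) + q * (\<omega> ^ 4 / (1 + \<omega>) * M)"
      unfolding \<theta>_def p_def q_def \<omega>_def by (simp add: add_divide_distrib algebra_simps)
    have "\<bar>p * (U Q - \<omega> ^ 3 / (1 + \<omega>) * M)\<bar> \<le> p * (7 * d)" "\<bar>q * (V Q - \<omega> ^ 4 / (1 + \<omega>) * M)\<bar> \<le> q * (7 * d)"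
      using Ub Vb pq by (simp_all add: abs_mult mult_left_mono)
    then have "\<bar>real (repeats_below G M) - \<theta> * M\<bar> \<le> (p + q) + p * (7 * d) + q * (7 * d)"
      using A unfolding \<theta> right_diff_distrib by linarith
    also have "\<dots> \<le> (p + q) * \<eta> M + p * (7 * d) + q * (7 * d)"
      using mult_left_mono[OF \<eta>1[of M], of "p + q"] pq by simp
    also have "\<dots> = ((p + q) * (7 * D + 1)) * \<eta> M" by (simp add: d_def algebra_simps)
    finally show ?thesis .
  qed
  then show ?thesis by blast
qed

text \<open>The indices with value at most \<open>X\<close> and the indices below \<open>r * X\<close> differ only for indices at a
  distance from \<open>r * X\<close> that the discrepancy controls.\<close>
lemma card_R_upto_asymp:
  assumes G: "G \<in> seqs g h"
  defines "r \<equiv> r_const g h G"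
    and "\<theta> \<equiv> (cells_p g h (G 1) (G 2) * omega g h ^ 3 + cells_m g h (G 1) (G 2) * omega g h ^ 4) / (1 + omega g h)"
  shows "(\<lambda>X. real (card (R_upto g h G X)) - r * (1 - \<theta>) * X) \<in> O(\<lambda>X. err g h X)"
proof -
  obtain \<eta> where error_gauge: "error_gauge \<eta>" using ex_error_gauge by blast
  then obtain D where D: "\<And>n. \<bar>discr n\<bar> \<le> D * \<eta> n" and \<eta>1: "\<And>n. 1 \<le> \<eta> n" and mono: "mono \<eta>"
    and scal: "\<And>a. \<exists>C. \<forall>n. \<eta> (a * n) \<le> C * \<eta> n" and \<eta>O: "\<eta> \<in> O(err g h)"
    unfolding error_gauge_def by blast
  have D0: "0 \<le> D"
  proof -
    have "0 \<le> D * \<eta> 0" using D[of 0] by linarith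
    then show ?thesis using \<eta>1[of 0] by (simp add: zero_le_mult_iff)
  qed
  obtain C1 where C1: "\<And>M. \<bar>real (repeats_below G M) - \<theta> * M\<bar> \<le> C1 * \<eta> M"
    using repeats_below_asymp[OF G error_gauge] unfolding \<theta>_def by blast
  have C10: "0 \<le> C1"
  proof -
    have "0 \<le> C1 * \<eta> 0" using C1[of 0] by linarith
    then show ?thesis using \<eta>1[of 0] by (simp add: zero_le_mult_iff)
  qed
  have r: "0 < r" using r_const_pos[OF G] by (simp add: r_def)
  (* A factor such that a * X bounds all indices in question: those of value at most X and those
     below r * X. *)
  define a where "a = g + 1 + nat \<lceil>r\<rceil>"
  have ar: "r \<le> a" unfolding a_def by linarith
  obtain C2 where C2: "\<And>n. \<eta> (a * n) \<le> C2 * \<eta> n" using scal by blast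
  define \<mu> where "\<mu> = \<bar>(real (G 1) - G 2 + g * G 1) / slope G\<bar>"
  have \<mu>0: "0 \<le> \<mu>" by (simp add: \<mu>_def)
  define K where "K = \<mu> * (D * C2) + 1"
  have near: "\<bar>real n - r * val G n\<bar> \<le> K * \<eta> X - 1" if "n \<le> a * X" for n X
  proof -
    have "\<bar>real n - r * val G n\<bar> = \<mu> * \<bar>discr n\<bar>"
      using val_discr[OF G, of n] unfolding r_def \<mu>_def by (simp flip: abs_mult)
    also have "\<dots> \<le> \<mu> * (D * (C2 * \<eta> X))"
    proof (intro mult_left_mono \<mu>0 order_trans[OF D] D0)
      show "\<eta> n \<le> C2 * \<eta> X" using monoD[OF mono that] C2[of X] by linarith
    qed
    also have "\<dots> \<le> K * \<eta> X - 1" using \<eta>1[of X] by (simp add: K_def algebra_simps)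
    finally show ?thesis .
  qed
  have main: "\<bar>real (card (R_upto g h G X)) - r * (1 - \<theta>) * X\<bar> \<le> (2 * K + 3 + \<bar>1 - \<theta>\<bar> + C1 * C2) * \<eta> X" for X
  proof -
    define M where "M = nat \<lfloor>r * X\<rfloor>"
    have "0 \<le> \<lfloor>r * X\<rfloor>" using r by simp
    then have M: "M \<le> r * X" "r * X < M + 1" unfolding M_def by linarith+
    define A where "A = {n. \<not> repeated G n \<and> 1 \<le> val G n \<and> val G n \<le> X}"
    define B where "B = {n. \<not> repeated G n \<and> n < M}"
    have Aa: "n \<le> a * X" if "n \<in> A" for n
    proof -
      have "n \<le> (g + 1) * val G n" by (rule val_ge[OF G])
      also have "\<dots> \<le> a * X" using that by (intro mult_mono) (auto simp: A_def a_def)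
      finally show ?thesis .
    qed
    have "r * X \<le> real a * X" using ar by (intro mult_right_mono) auto
    then have "real M \<le> real (a * X)" using M by simp
    then have Ma: "M \<le> a * X" by (simp only: of_nat_le_iff)
    have finA: "finite A" using Aa by (intro finite_subset[of A "{..a * X}"]) auto
    have finB: "finite B" by (simp add: B_def)
    (* Index 0 has the value 0, which does not belong to R, so it is set aside. *)
    define S where "S = (A - B) \<union> (B - A) - {0}"
    have S: "\<bar>real n - r * X\<bar> \<le> K * \<eta> X" if n: "n \<in> S" for n
    proof (cases "n \<in> A")
      case True
      then have "M \<le> n" "val G n \<le> X" using n by (auto simp: S_def A_def B_def)
      then have "r * val G n \<le> r * X" using r by simp
      then show ?thesis using near[OF Aa[OF True]] \<open>M \<le> n\<close> M by linarith
    next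
      case False
      then have nB: "n \<in> B" "n \<noteq> 0" using n by (auto simp: S_def)
      then have "1 \<le> val G n" using val_ge[OF G, of n] by (cases "val G n") auto
      then have "X < val G n" "n < M" using nB False by (auto simp: A_def B_def)
      then have "r * X \<le> r * val G n" using r by simp
      moreover have "n \<le> a * X" using \<open>n < M\<close> Ma by simp
      ultimately show ?thesis using near[of n X] \<open>n < M\<close> M by linarith
    qed
    have K0: "0 \<le> K * \<eta> X" using near[of 0 X] by linarith
    have finS: "finite S" and cardS: "real (card S) \<le> 2 * (K * \<eta> X) + 1"
      by (rule card_near_le[OF K0], erule S)+
    have "card ((A - B) \<union> (B - A)) \<le> card (insert 0 S)" using finS by (intro card_mono) (auto simp: S_def)
    also have "\<dots> \<le> card S + 1" using finS by (simp add: card_insert_if)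
    finally have AB: "\<bar>real (card A) - real (card B)\<bar> \<le> 2 * (K * \<eta> X) + 2"
      using card_diff_le_card_sym_diff[OF finA finB] cardS by linarith
    have "B \<union> {n. n < M \<and> repeated G n} = {..<M}" by (auto simp: B_def)
    moreover have "card (B \<union> {n. n < M \<and> repeated G n}) = card B + repeats_below G M"
      unfolding repeats_below_def using finB by (intro card_Un_disjoint) (auto simp: B_def)
    ultimately have "real (card B) = M - real (repeats_below G M)" by simp
    moreover have "\<bar>real (repeats_below G M) - \<theta> * M\<bar> \<le> C1 * (C2 * \<eta> X)"
      using C1[of M] mult_left_mono[OF order_trans[OF monoD[OF mono Ma] C2] C10] by linarith
    ultimately have BM: "\<bar>real (card B) - (1 - \<theta>) * M\<bar> \<le> C1 * C2 * \<eta> X"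
      by (simp add: algebra_simps)
    have "\<bar>(1 - \<theta>) * (r * X) - (1 - \<theta>) * M\<bar> \<le> \<bar>1 - \<theta>\<bar>"
    proof -
      have "\<bar>1 - \<theta>\<bar> * \<bar>r * X - M\<bar> \<le> \<bar>1 - \<theta>\<bar> * 1" using M by (intro mult_left_mono) auto
      then show ?thesis by (simp flip: abs_mult right_diff_distrib)
    qed
    then have "\<bar>real (card A) - r * (1 - \<theta>) * X\<bar> \<le> 2 * (K * \<eta> X) + 2 + C1 * C2 * \<eta> X + \<bar>1 - \<theta>\<bar>"
      using AB BM by (simp add: algebra_simps)
    also have "\<dots> \<le> 2 * (K * \<eta> X) + 3 * \<eta> X + C1 * C2 * \<eta> X + \<bar>1 - \<theta>\<bar> * \<eta> X"
      using \<eta>1[of X] mult_left_mono[OF \<eta>1[of X], of "\<bar>1 - \<theta>\<bar>"] by simp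
    also have "\<dots> = (2 * K + 3 + \<bar>1 - \<theta>\<bar> + C1 * C2) * \<eta> X" by (simp add: algebra_simps)
    finally show ?thesis using card_R_upto[OF G, of X] by (simp add: A_def)
  qed
  have "(\<lambda>X. real (card (R_upto g h G X)) - r * (1 - \<theta>) * X) \<in> O(\<eta>)"
    by (rule bigoI[of _ "2 * K + 3 + \<bar>1 - \<theta>\<bar> + C1 * C2"])
       (use main order_trans[OF zero_le_one \<eta>1] in \<open>auto simp: always_eventually\<close>)
  then show ?thesis using \<eta>O by (rule landau_o.big_trans)
qed

end

theorem theorem2p13:
  shows "(\<exists>c :: nat \<Rightarrow> nat list \<Rightarrow> nat.
            (\<forall>k\<in>{1..5}. total_recursive 4 (c k)) \<and>
            (\<forall>g h G. 1 \<le> g \<longrightarrow> 1 \<le> h \<longrightarrow> G \<in> seqs g h \<longrightarrow>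
              (let p = r_const g h G / (1 + omega g h) *
                       (1 + omega g h - (\<Sum>k=1..5. real (c k [g, h, G 1, G 2]) * omega g h ^ k))
               in (\<lambda>X. real (card (R_upto g h G X)) - p * real X) \<in> O(\<lambda>X. err g h X)) \<and>
              (unique_expansion g h G \<longrightarrow>
                 (\<forall>k\<in>{1..5}. c k [g, h, G 1, G 2] = 0) \<and>
                 (\<lambda>X. real (card (R_upto g h G X)) - r_const g h G * real X) \<in> O(\<lambda>X. err g h X)))) \<and>
         (\<forall>g h G. 1 \<le> g \<longrightarrow> 1 \<le> h \<longrightarrow> G \<in> seqs g h \<longrightarrow>
            (G 2 > g * G 1 \<or>
             G 2 > max g (h - 1) \<or>
             (g \<le> h - 1 \<and> G 1 > g + h) \<or>
             (g \<ge> h \<and> (real (G 1) > real g * (ell0 g h G + 1) + real h \<or>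
                         real (G 1) \<ge> (real g ^ 2 + real g * real h + real h ^ 2) / real h))) \<longrightarrow>
            unique_expansion g h G)"
proof (intro conjI allI impI)
  define c :: "nat \<Rightarrow> nat list \<Rightarrow> nat" where
    "c k = (if k = 3 then (\<lambda>xs. cells_p (xs ! 0) (xs ! 1) (xs ! 2) (xs ! 3))
            else if k = 4 then (\<lambda>xs. cells_m (xs ! 0) (xs ! 1) (xs ! 2) (xs ! 3))
            else (\<lambda>_. 0))" for k
  have c: "c 3 [g, h, a, b] = cells_p g h a b" "c 4 [g, h, a, b] = cells_m g h a b"
    "k \<noteq> 3 \<Longrightarrow> k \<noteq> 4 \<Longrightarrow> c k [g, h, a, b] = 0" for g h a b k
    by (simp_all add: c_def)
  show "\<exists>c :: nat \<Rightarrow> nat list \<Rightarrow> nat.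
            (\<forall>k\<in>{1..5}. total_recursive 4 (c k)) \<and>
            (\<forall>g h G. 1 \<le> g \<longrightarrow> 1 \<le> h \<longrightarrow> G \<in> seqs g h \<longrightarrow>
              (let p = r_const g h G / (1 + omega g h) *
                       (1 + omega g h - (\<Sum>k=1..5. real (c k [g, h, G 1, G 2]) * omega g h ^ k))
               in (\<lambda>X. real (card (R_upto g h G X)) - p * real X) \<in> O(\<lambda>X. err g h X)) \<and>
              (unique_expansion g h G \<longrightarrow>
                 (\<forall>k\<in>{1..5}. c k [g, h, G 1, G 2] = 0) \<and>
                 (\<lambda>X. real (card (R_upto g h G X)) - r_const g h G * real X) \<in> O(\<lambda>X. err g h X)))"
  proof (intro exI[of _ c] conjI ballI allI impI)
    show "total_recursive 4 (c k)" for k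
      using total_recursive_cells_p total_recursive_cells_m by (simp add: c_def total_recursive.zero)
  next
    fix g h :: nat and G assume *: "1 \<le> g" "1 \<le> h" and G: "G \<in> seqs g h"
    interpret expansions g h by unfold_locales (rule *)+
    have "0 < 1 + omega g h" using alpha_gt by (simp add: omega_def add_pos_pos)
    moreover have "x / y * (y - z) = x * (1 - z / y)" if "0 < y" for x y z :: real
      using that by (simp add: field_simps)
    moreover have "(\<Sum>k=1..5. real (c k [g, h, G 1, G 2]) * omega g h ^ k) =
        cells_p g h (G 1) (G 2) * omega g h ^ 3 + cells_m g h (G 1) (G 2) * omega g h ^ 4"
    proof -
      have "{1..5::nat} = {1, 2, 3, 4, 5}" by auto
      then show ?thesis by (simp add: c)
    qed
    ultimately have p: "r_const g h G / (1 + omega g h) *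
            (1 + omega g h - (\<Sum>k=1..5. real (c k [g, h, G 1, G 2]) * omega g h ^ k)) =
          r_const g h G * (1 - (cells_p g h (G 1) (G 2) * omega g h ^ 3 +
            cells_m g h (G 1) (G 2) * omega g h ^ 4) / (1 + omega g h))"
      by simp
    show "let p = r_const g h G / (1 + omega g h) *
            (1 + omega g h - (\<Sum>k=1..5. real (c k [g, h, G 1, G 2]) * omega g h ^ k))
          in (\<lambda>X. real (card (R_upto g h G X)) - p * real X) \<in> O(\<lambda>X. err g h X)"
      unfolding Let_def p by (rule card_R_upto_asymp[OF G])
    assume "unique_expansion g h G"
    note zero = cells_eq_0_if_unique[OF G this]
    show "c k [g, h, G 1, G 2] = 0" for k
      using c zero by (cases "k = 3"; cases "k = 4") auto
    show "(\<lambda>X. real (card (R_upto g h G X)) - r_const g h G * real X) \<in> O(\<lambda>X. err g h X)"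
      using card_R_upto_asymp[OF G] unfolding zero by simp
  qed
next
  fix g h :: nat and G
  assume *: "1 \<le> g" "1 \<le> h" and G: "G \<in> seqs g h"
    and crit: "G 2 > g * G 1 \<or> G 2 > max g (h - 1) \<or> (g \<le> h - 1 \<and> G 1 > g + h) \<or>
             (g \<ge> h \<and> (real (G 1) > real g * (ell0 g h G + 1) + real h \<or>
                         real (G 1) \<ge> (real g ^ 2 + real g * real h + real h ^ 2) / real h))"
  interpret expansions g h by unfold_locales (rule *)+
  show "unique_expansion g h G" by (rule unique_expansion_criteria[OF G crit])
qed

end
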